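(* Let $\alpha_1$ be a Liouville number and let $\gamma_1,\gamma_2\in\mathbb{R}$. Then for almost all $\alpha_2\in\mathbb{R}$, \[\liminf_{n\to\infty} n(\log n)^2\|n\alpha_1-\gamma_1\|\cdot\|n\alpha_2-\gamma_2\|=0.\]
   Context: $\|x\|$ denotes the distance from $x$ to the nearest integer. A Liouville number is an irrational $\alpha$ such that for every $w>0$ the inequality $\|n\alpha\|<n^{-w}$ holds for infinitely many $n\in\mathbb{N}$. "Almost all" refers to Lebesgue measure. *)

theory Defs
  imports "HOL-Analysis.Analysis"
begin

definition dist_int :: "real \<Rightarrow> real"
  where "dist_int x = infdist x \<int>"

text \<open>The infimum in \<^const>\<open>infdist\<close> is attained at a nearest integer.\<close>

lemma dist_int_eq_round: "dist_int x = \<bar>x - of_int (round x)\<bar>"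
proof (rule antisym)
  show "dist_int x \<le> \<bar>x - of_int (round x)\<bar>"
    unfolding dist_int_def using infdist_le[of "of_int (round x)" \<int> x] by (simp add: dist_real_def)
  have ne: "(\<int> :: real set) \<noteq> {}"
    using Ints_0 by blast
  show "\<bar>x - of_int (round x)\<bar> \<le> dist_int x"
    unfolding dist_int_def infdist_notempty[OF ne]
    using ne round_diff_minimal[of x]
    by (intro cINF_greatest) (auto simp: dist_real_def elim!: Ints_cases)
qed

definition liouville_number :: "real \<Rightarrow> bool"
  where "liouville_number \<alpha> \<longleftrightarrow>
    \<alpha> \<notin> \<rat> \<and>
    (\<forall>w::real. w > 0 \<longrightarrow>
      infinite {n::nat. n \<ge> 1 \<and> dist_int (real n * \<alpha>) < real n powr (- w)})"

end

(* Let p / q be a very good approximation of alpha_1, and put lam = ln q up to a constant. For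
   q^2 <= n < q^3 the distance of n alpha_1 - gamma_1 to the integers is about t / q, where
   n p = floor (q gamma_1) + t (mod q), so a small multiple of sum 1 / (n (ln n)^2 (t / q)) over these n
   and over K <= t < K^2, with K a small power of q, is of constant size: each of the sums of 1 / n and
   of 1 / t contributes a factor lam. Hence the balls of alpha_2 for which n succeeds have total
   measure bounded below, and this holds on every subinterval once q is large. The overlap of the
   balls of n and m is governed by gcd (n, m); writing n = a d, m = b d, the rigidity of the residues t
   bounds the overlaps with b < q / (2 K^2), and the remaining ones are negligible because d is then
   small. So the counting functions of the balls have bounded second moments and uniformly positive
   mass on all intervals, and no set of positive measure can be avoided by infinitely many of them. *)
theory Submission
  imports Defs
begin

text \<open>With the factor (ln n)^2 the total mass is only just bounded below: both logarithms are
  used up, so the correlation sum over gcd (n, m) must be O(lam^2) with no logarithm to spare.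
  Counting the d in pairs (a d, b d) without further structure gives about lam^2 / b^2; there are up
  to b choices of a, and the sum over b would cost a third factor lam. The rigidity of the residues
  supplies the missing 1 / b. It fails for large b, but there powers of K can be given away, since q
  is a large power of K. The one danger is a big common factor of n and q, which makes residues
  repeat too often; such n are excluded, at the cost of at most two values of t.

  The moment bounds hold only up to constants, so on their own they would yield positive measure,
  not full measure. Uniform mass on every cell of length 1 / N takes the place of a zero-one law.
  Both shifts are harmless: gamma_1 cancels in differences of residues, and gamma_2 only translates
  an interval whose integer points are counted.\<close>

section \<open>A criterion for null sets\<close>

text \<open>The mass bound on the cells says that the functions f converge weakly to something bounded
  below by c, and the bound on the second moments lets one test this against the indicator of V,
  although V is not a union of cells.\<close>

lemma null_set_by_uniform_mass:
  fixes V :: "real set" and c C :: real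
  assumes V: "V \<in> sets lebesgue" "V \<subseteq> {0..<1}" and "c > 0" "C > 0"
    and ex: "\<And>N::nat. N \<ge> 1 \<Longrightarrow> \<exists>f::real \<Rightarrow> real. integrable lebesgue f
      \<and> integrable lebesgue (\<lambda>x. (f x)\<^sup>2) \<and> (\<integral>x. (f x)\<^sup>2 \<partial>lebesgue) \<le> C
      \<and> (\<forall>x\<in>V. f x = 0)
      \<and> (\<forall>i<N. c / real N \<le> (\<integral>x. indicator {real i / real N..<(real i + 1) / real N} x * f x \<partial>lebesgue))"
  shows "V \<in> null_sets lebesgue"
proof (rule ccontr)
  assume nonnull: "V \<notin> null_sets lebesgue"
  have bV: "bounded V"
    using V(2) by (rule bounded_subset[rotated]) (auto intro: bounded_subset[OF bounded_cbox[of 0 "1::real"]])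
  have Vm: "V \<in> lmeasurable"
    using V(1) bV by (rule bounded_set_imp_lmeasurable[rotated])
  define v where "v = measure lebesgue V"
  have "v > 0"
    using nonnull Vm unfolding v_def
    by (metis measure_nonneg order_le_less negligible_iff_measure negligible_iff_null_sets)
  \<comment> \<open>With f \<le> s / 2 * f^2 + 1 / (2 * s) below, these choices make s / 2 * C and
    \<eta> / (2 * s) both equal to c * v / 4.\<close>
  define s where "s = c * v / (2 * C)"
  define \<eta> where "\<eta> = s * c * v / 2"
  have "s > 0" "\<eta> > 0"
    using \<open>c > 0\<close> \<open>C > 0\<close> \<open>v > 0\<close> by (auto simp: s_def \<eta>_def)
  obtain U where U: "open U" "V \<subseteq> U" "U - V \<in> lmeasurable" "emeasure lebesgue (U - V) < ennreal \<eta>"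
    using sets_lebesgue_outer_open[OF V(1) \<open>\<eta> > 0\<close>] by blast
  obtain K where K: "closed K" "K \<subseteq> V" "V - K \<in> lmeasurable" "emeasure lebesgue (V - K) < ennreal (v / 2)"
    using sets_lebesgue_inner_closed[OF V(1), of "v / 2"] \<open>v > 0\<close> by auto
  have mUV: "measure lebesgue (U - V) < \<eta>"
    using U(3,4) \<open>\<eta> > 0\<close> by (simp add: emeasure_eq_measure2 ennreal_less_iff)
  have "compact K"
    using K(1,2) bV by (meson bounded_subset compact_eq_bounded_closed)
  have Km: "K \<in> lmeasurable"
    using \<open>compact K\<close> by (rule lmeasurable_compact)
  have "measure lebesgue (V - K) < v / 2"
    using K(3,4) \<open>v > 0\<close> by (simp add: emeasure_eq_measure2 ennreal_less_iff)
  then have mK: "measure lebesgue K > v / 2"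
    using measurable_measure_Diff[OF Vm fmeasurableD[OF Km] K(2)] by (simp add: v_def)
  obtain d where d: "d > 0" "\<And>x y. x \<in> K \<Longrightarrow> y \<in> - U \<Longrightarrow> d \<le> dist x y"
  proof -
    have "K \<inter> - U = {}" using U(2) K(2) by blast
    then show ?thesis
      using separate_compact_closed[OF \<open>compact K\<close>, of "- U"] U(1) that by (auto simp: closed_Compl)
  qed
  obtain N :: nat where N: "1 / d < real N"
    using reals_Archimedean2 by blast
  have "real N > 0"
    using N d(1) by (meson less_trans zero_less_divide_1_iff)
  then have N1: "N \<ge> 1" by simp
  have Nd: "1 / real N < d"
    using N d(1) \<open>real N > 0\<close> by (simp add: field_simps)
  define cell where "cell i = {real i / real N..<(real i + 1) / real N}" for i :: nat
  define I where "I = {i. i < N \<and> cell i \<inter> K \<noteq> {}}"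
  have finI: "finite I" by (simp add: I_def)
  obtain f where f: "integrable lebesgue f" "integrable lebesgue (\<lambda>x. (f x)\<^sup>2)"
      "(\<integral>x. (f x)\<^sup>2 \<partial>lebesgue) \<le> C" "\<And>x. x \<in> V \<Longrightarrow> f x = 0"
      "\<And>i. i < N \<Longrightarrow> c / real N \<le> (\<integral>x. indicator (cell i) x * f x \<partial>lebesgue)"
    using ex[OF N1] unfolding cell_def by blast
  have cell_idx: "i = nat \<lfloor>x * real N\<rfloor>" if "x \<in> cell i" for x i
    using that \<open>real N > 0\<close> by (auto simp: cell_def field_simps nat_eq_iff floor_eq_iff intro!: sym[of _ i])
  have disj: "disjoint_family_on cell I"
    unfolding disjoint_family_on_def by (metis cell_idx disjoint_iff)
  have in_cell: "x \<in> cell (nat \<lfloor>x * real N\<rfloor>) \<and> nat \<lfloor>x * real N\<rfloor> < N" if "x \<in> K" for x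
  proof -
    have x: "0 \<le> x" "x < 1" using that K(2) V(2) by force+
    have "real (nat \<lfloor>x * real N\<rfloor>) = of_int \<lfloor>x * real N\<rfloor>"
      using x by simp
    moreover have "of_int \<lfloor>x * real N\<rfloor> \<le> x * real N" "x * real N < of_int \<lfloor>x * real N\<rfloor> + 1"
      by linarith+
    moreover have "x * real N < real N" using x \<open>real N > 0\<close> by simp
    ultimately have "real (nat \<lfloor>x * real N\<rfloor>) \<le> x * real N"
        "x * real N < real (nat \<lfloor>x * real N\<rfloor>) + 1" "real (nat \<lfloor>x * real N\<rfloor>) < real N"
      by linarith+
    then show ?thesis using \<open>real N > 0\<close>
      unfolding cell_def by (auto simp: field_simps)
  qed
  \<comment> \<open>Cells are shorter than the distance from K to the complement of U, so those
    meeting K stay inside U. On W the function f therefore lives on U - V, a set of measure below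
    \<eta>, while the cells of W carry mass more than c * v / 2.\<close>
  define W where "W = (\<Union>i\<in>I. cell i)"
  have KW: "K \<subseteq> W"
    using in_cell by (fastforce simp: W_def I_def)
  have WU: "W \<subseteq> U"
  proof
    fix y assume "y \<in> W"
    then obtain i x where ix: "y \<in> cell i" "x \<in> cell i" "x \<in> K"
      by (auto simp: W_def I_def)
    have "\<bar>x - y\<bar> \<le> 1 / real N"
      using ix(1,2) by (auto simp: cell_def abs_le_iff add_divide_distrib)
    then have "dist x y < d"
      using Nd by (simp add: dist_real_def)
    then show "y \<in> U"
      using d(2)[OF ix(3), of y] by force
  qed
  have cm: "cell i \<in> lmeasurable" for i
    by (rule bounded_set_imp_lmeasurable)
      (auto simp: cell_def intro: bounded_subset[OF bounded_cbox[of "real i / real N" "(real i + 1) / real N"]])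
  have cmeas: "measure lebesgue (cell i) = 1 / real N" for i
    using \<open>real N > 0\<close> by (simp add: cell_def field_simps)
  have Wm: "W \<in> lmeasurable"
    unfolding W_def using finI cm by (intro fmeasurable.finite_UN) auto
  have "measure lebesgue K \<le> measure lebesgue W"
    using KW Km Wm by (intro measure_mono_fmeasurable) auto
  also have "\<dots> \<le> (\<Sum>i\<in>I. measure lebesgue (cell i))"
    unfolding W_def using finI cm by (intro measure_UNION_le) auto
  finally have "measure lebesgue K \<le> real (card I) / real N"
    by (simp add: cmeas)
  with mK have cardI: "v / 2 < real (card I) / real N"
    by linarith
  have indW: "indicator W x = (\<Sum>i\<in>I. indicator (cell i) x :: real)" for x
    unfolding W_def using indicator_UN_disjoint[OF finI disj] by simp
  have fint: "integrable lebesgue (\<lambda>x. indicator A x * f x)" if "A \<in> sets lebesgue" for A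
    using integrable_mult_indicator[OF that f(1)] by simp
  have "c * v / 2 < c * (real (card I) / real N)"
    using cardI \<open>c > 0\<close> by (simp add: mult.assoc mult_less_cancel_left_pos flip: times_divide_eq_right)
  also have "\<dots> = (\<Sum>i\<in>I. c / real N)" by simp
  also have "\<dots> \<le> (\<Sum>i\<in>I. (\<integral>x. indicator (cell i) x * f x \<partial>lebesgue))"
    by (intro sum_mono f(5)) (auto simp: I_def)
  also have "\<dots> = (\<integral>x. indicator W x * f x \<partial>lebesgue)"
    unfolding indW sum_distrib_right
    by (subst Bochner_Integration.integral_sum) (auto intro!: fint fmeasurableD cm)
  also have "\<dots> \<le> (\<integral>x. s / 2 * (f x)\<^sup>2 + 1 / (2 * s) * indicator (U - V) x \<partial>lebesgue)"
  proof (rule integral_mono)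
    show "integrable lebesgue (\<lambda>x. indicator W x * f x)"
      by (intro fint fmeasurableD Wm)
    show "integrable lebesgue (\<lambda>x. s / 2 * (f x)\<^sup>2 + 1 / (2 * s) * indicator (U - V) x)"
      using f(2) U(3) by (intro Bochner_Integration.integrable_add integrable_mult_right
            integrable_real_indicator fmeasurableD) (auto simp: fmeasurable_def)
    fix x
    have amgm: "f x \<le> s / 2 * (f x)\<^sup>2 + 1 / (2 * s)"
    proof -
      have "0 \<le> (s * f x - 1)\<^sup>2" by simp
      then have "2 * (s * f x) \<le> s\<^sup>2 * (f x)\<^sup>2 + 1"
        by (simp add: power2_eq_square algebra_simps)
      then have "2 * (s * f x) / (2 * s) \<le> (s\<^sup>2 * (f x)\<^sup>2 + 1) / (2 * s)"
        using \<open>s > 0\<close> by (intro divide_right_mono) auto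
      then show ?thesis
        using \<open>s > 0\<close> by (simp add: add_divide_distrib power2_eq_square)
    qed
    show "indicator W x * f x \<le> s / 2 * (f x)\<^sup>2 + 1 / (2 * s) * indicator (U - V) x"
      using amgm WU f(4)[of x] \<open>s > 0\<close>
      by (auto simp: indicator_def)
  qed
  also have "\<dots> = s / 2 * (\<integral>x. (f x)\<^sup>2 \<partial>lebesgue) + 1 / (2 * s) * measure lebesgue (U - V)"
    using f(2) U(3) by (subst Bochner_Integration.integral_add)
      (auto intro!: integrable_mult_right integrable_real_indicator simp: fmeasurable_def)
  also have "\<dots> \<le> s / 2 * C + 1 / (2 * s) * \<eta>"
    using f(3) mUV \<open>s > 0\<close> by (intro add_mono mult_left_mono) auto
  also have "\<dots> = c * v / 2"
    using \<open>s > 0\<close> \<open>C > 0\<close> \<open>c > 0\<close> \<open>v > 0\<close> by (simp add: s_def \<eta>_def field_simps)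
  finally show False by simp
qed

section \<open>Moments of counting functions of balls around fractions\<close>

lemma card_int_interval_le:
  fixes A B :: real
  assumes "A \<le> B"
  shows "finite {z::int. A \<le> z \<and> z \<le> B}" "real (card {z::int. A \<le> z \<and> z \<le> B}) \<le> B - A + 1"
proof -
  have eq: "{z::int. A \<le> z \<and> z \<le> B} = {\<lceil>A\<rceil>..\<lfloor>B\<rfloor>}"
    by (auto simp: ceiling_le_iff le_floor_iff)
  show "finite {z::int. A \<le> z \<and> z \<le> B}"
    unfolding eq by simp
  have "real_of_int \<lfloor>B\<rfloor> \<le> B" "A \<le> real_of_int \<lceil>A\<rceil>" by auto
  then show "real (card {z::int. A \<le> z \<and> z \<le> B}) \<le> B - A + 1"
    unfolding eq using assms by (cases "\<lfloor>B\<rfloor> + 1 - \<lceil>A\<rceil> \<ge> 0"; simp; linarith)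
qed

text \<open>Write n = d n' and m = d m' with d the gcd. Closeness puts the integer m' x - n' y into
  an interval of length 2 n m R / d, which g merely translates, and each integer is attained at most
  d times.\<close>

lemma card_close_fractions:
  fixes n m :: nat and g R :: real
  assumes "n > 0" "m > 0" "R \<ge> 0"
  shows "real (card {(x, y). x < n \<and> y < m \<and> \<bar>(real x + g) / real n - (real y + g) / real m\<bar> \<le> R})
    \<le> 2 * real n * real m * R + real (gcd n m)"
proof -
  define P where "P = {(x, y). x < n \<and> y < m \<and> \<bar>(real x + g) / real n - (real y + g) / real m\<bar> \<le> R}"
  define d where "d = gcd n m"
  have "d > 0" using assms by (simp add: d_def)
  obtain n' m' where nm: "n = d * n'" "m = d * m'" and cop: "coprime n' m'"
    using gcd_coprime_exists[of n m] \<open>d > 0\<close> unfolding d_def by (metis less_irrefl mult.commute)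
  have "n' > 0" "m' > 0" using nm assms by auto
  define e where "e = (real m - real n) * g"
  define T where "T = real n * real m * R"
  have "T \<ge> 0" using assms by (simp add: T_def)
  define Z where "Z = {z::int. (- T - e) / real d \<le> z \<and> z \<le> (T - e) / real d}"
  have le: "(- T - e) / real d \<le> (T - e) / real d"
    using \<open>T \<ge> 0\<close> \<open>d > 0\<close> by (intro divide_right_mono) auto
  \<comment> \<open>For a fixed first component x is determined modulo n', and x div n' < d tells
    the solutions apart.\<close>
  define key where "key = (\<lambda>(x, y). (int m' * int x - int n' * int y, x div n'))"
  have sub: "key ` P \<subseteq> Z \<times> {..<d}"
  proof
    fix k assume "k \<in> key ` P"
    then obtain x y where xy: "x < n" "y < m" "\<bar>(real x + g) / real n - (real y + g) / real m\<bar> \<le> R"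
        "k = (int m' * int x - int n' * int y, x div n')"
      by (auto simp: P_def key_def)
    have "real d * real_of_int (int m' * int x - int n' * int y) + e
        = real n * real m * ((real x + g) / real n - (real y + g) / real m)"
      using assms(1,2) by (simp add: e_def field_simps) (simp add: nm algebra_simps)
    then have "\<bar>real d * real_of_int (int m' * int x - int n' * int y) + e\<bar> \<le> T"
      using xy(3) assms by (simp add: T_def abs_mult mult_left_mono)
    then have "int m' * int x - int n' * int y \<in> Z"
      unfolding Z_def using \<open>d > 0\<close> by (simp add: divide_le_eq le_divide_eq abs_le_iff mult.commute)
    moreover have "x div n' < d"
      using xy(1) nm \<open>n' > 0\<close> by (simp add: less_mult_imp_div_less)
    ultimately show "k \<in> Z \<times> {..<d}"
      using xy(4) by simp
  qed
  have inj: "inj_on key P"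
  proof (rule inj_onI, clarify)
    fix x y u v assume "(x, y) \<in> P" "(u, v) \<in> P" and eq: "key (x, y) = key (u, v)"
    have 1: "int m' * (int x - int u) = int n' * (int y - int v)" and 2: "x div n' = u div n'"
      using eq by (auto simp: key_def algebra_simps)
    have "int n' dvd int m' * (int x - int u)" using 1 by simp
    then have "int n' dvd int x - int u"
      using cop by (simp add: coprime_dvd_mult_right_iff)
    then have "x mod n' = u mod n'"
      by (metis mod_eq_dvd_iff of_nat_eq_iff of_nat_mod)
    then have "x = u" using 2 by (metis div_mult_mod_eq)
    then show "x = u \<and> y = v" using 1 \<open>n' > 0\<close> by simp
  qed
  have "real (card P) = real (card (key ` P))"
    using inj by (simp add: card_image)
  also have "\<dots> \<le> real (card (Z \<times> {..<d}))"
    using sub card_int_interval_le(1)[OF le] unfolding Z_def[symmetric]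
    by (intro of_nat_mono card_mono) auto
  also have "\<dots> = real (card Z) * real d" by (simp add: card_cartesian_product)
  also have "\<dots> \<le> ((T - e) / real d - (- T - e) / real d + 1) * real d"
    using card_int_interval_le(2)[OF le] unfolding Z_def by (intro mult_right_mono) auto
  also have "\<dots> = 2 * real n * real m * R + real d"
    using \<open>d > 0\<close> by (simp add: field_simps T_def)
  finally show ?thesis unfolding P_def d_def .
qed

text \<open>The centres of one period are counted and balls are not wrapped around at 0 and 1; for
  lower bounds on subintervals of [0, 1) this suffices.\<close>

definition fraction_balls :: "nat set \<Rightarrow> (nat \<Rightarrow> real) \<Rightarrow> real \<Rightarrow> real \<Rightarrow> real"
  where "fraction_balls S \<rho> g z =
    (\<Sum>(n, x)\<in>(SIGMA n:S. {..<n}). indicator (cball ((real x + g) / real n) (\<rho> n)) z)"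

lemma measure_cball_Int_le:
  fixes a b r s :: real
  assumes "r \<ge> 0" "s \<ge> 0"
  shows "measure lebesgue (cball a r \<inter> cball b s) \<le> (if \<bar>a - b\<bar> \<le> r + s then 2 * min r s else 0)"
proof (cases "\<bar>a - b\<bar> \<le> r + s")
  case True
  have "measure lebesgue (cball a r \<inter> cball b s) \<le> measure lebesgue (cball a r)"
    "measure lebesgue (cball a r \<inter> cball b s) \<le> measure lebesgue (cball b s)"
    by (intro measure_mono_fmeasurable; auto intro!: fmeasurableD lmeasurable_cball)+
  moreover have "measure lebesgue (cball a r) = 2 * r" "measure lebesgue (cball b s) = 2 * s"
    using assms by (simp_all add: cball_eq_atLeastAtMost)
  ultimately show ?thesis
    using True by auto
next
  case False
  have "cball a r \<inter> cball b s = {}"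
  proof (rule ccontr)
    assume "cball a r \<inter> cball b s \<noteq> {}"
    then obtain z where "\<bar>a - z\<bar> \<le> r" "\<bar>b - z\<bar> \<le> s"
      by (auto simp: dist_real_def)
    then show False using False by linarith
  qed
  then show ?thesis using False by simp
qed

lemma integrable_cball_indicator: "integrable lebesgue (indicat_real (cball a r))" for a r :: real
  using lmeasurable_cball[of a r] by (simp add: fmeasurable_def integrable_real_indicator)

context
  fixes S :: "nat set" and \<rho> :: "nat \<Rightarrow> real" and g :: real
  assumes finS: "finite S" and posS: "\<And>n. n \<in> S \<Longrightarrow> n > 0" and \<rho>: "\<And>n. n \<in> S \<Longrightarrow> \<rho> n \<ge> 0"
begin

lemma fraction_balls_integrable: "integrable lebesgue (fraction_balls S \<rho> g)"
  unfolding fraction_balls_def[abs_def] case_prod_beta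
  by (intro Bochner_Integration.integrable_sum integrable_cball_indicator)

text \<open>Squaring counts pairs of intersecting balls. For a pair n, m the term 2 n m R of
  \<open>card_close_fractions\<close> is what independence would give up to a constant; the gcd is
  the surplus from nearly coinciding centres.\<close>

lemma fraction_balls_second_moment:
  shows "integrable lebesgue (\<lambda>z. (fraction_balls S \<rho> g z)\<^sup>2)"
    and "(\<integral>z. (fraction_balls S \<rho> g z)\<^sup>2 \<partial>lebesgue) \<le> 8 * (\<Sum>n\<in>S. real n * \<rho> n)\<^sup>2
      + 4 * (\<Sum>m\<in>S. \<Sum>n\<in>{n \<in> S. n \<le> m}. real (gcd n m) * \<rho> m)"
proof -
  define P where "P = (SIGMA n:S. {..<n})"
  define D where "D i = cball ((real (snd i) + g) / real (fst i)) (\<rho> (fst i))" for i :: "nat \<times> nat"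
  have f_eq: "fraction_balls S \<rho> g z = (\<Sum>i\<in>P. indicator (D i) z)" for z
    by (simp add: fraction_balls_def P_def D_def case_prod_beta)
  have sq: "(fraction_balls S \<rho> g z)\<^sup>2 = (\<Sum>i\<in>P. \<Sum>j\<in>P. indicator (D i \<inter> D j) z)" for z
    unfolding f_eq power2_eq_square sum_product by (simp add: indicator_inter_arith)
  have Dm: "D i \<inter> D j \<in> lmeasurable" for i j
    unfolding D_def by (intro fmeasurable.Int lmeasurable_cball)
  have int: "integrable lebesgue (indicat_real (D i \<inter> D j))" for i j
    using Dm[of i j] by (intro integrable_real_indicator) (auto simp: fmeasurable_def)
  show "integrable lebesgue (\<lambda>z. (fraction_balls S \<rho> g z)\<^sup>2)"
    unfolding sq by (intro Bochner_Integration.integrable_sum int)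
  have "(\<integral>z. (fraction_balls S \<rho> g z)\<^sup>2 \<partial>lebesgue) = (\<Sum>i\<in>P. \<Sum>j\<in>P. measure lebesgue (D i \<inter> D j))"
    unfolding sq by (simp add: Bochner_Integration.integral_sum int integrable_sum)
  also have "\<dots> \<le> (\<Sum>i\<in>P. \<Sum>j\<in>P.
      if \<bar>(real (snd i) + g) / real (fst i) - (real (snd j) + g) / real (fst j)\<bar> \<le> \<rho> (fst i) + \<rho> (fst j)
      then 2 * min (\<rho> (fst i)) (\<rho> (fst j)) else 0)"
    unfolding D_def by (intro sum_mono measure_cball_Int_le) (auto simp: P_def \<rho>)
  also have "\<dots> = (\<Sum>n\<in>S. \<Sum>m\<in>S. \<Sum>x<n. \<Sum>y<m.
      if \<bar>(real x + g) / real n - (real y + g) / real m\<bar> \<le> \<rho> n + \<rho> m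
      then 2 * min (\<rho> n) (\<rho> m) else 0)"
  proof -
    have sumP: "(\<Sum>i\<in>P. h (fst i) (snd i)) = (\<Sum>n\<in>S. \<Sum>x<n. h n x)" for h :: "nat \<Rightarrow> nat \<Rightarrow> real"
      unfolding P_def by (subst sum.Sigma) (auto simp: finS case_prod_beta)
    define F where "F n x m y = (if \<bar>(real x + g) / real n - (real y + g) / real m\<bar> \<le> \<rho> n + \<rho> m
      then 2 * min (\<rho> n) (\<rho> m) else 0)" for n x m y
    have "(\<Sum>i\<in>P. \<Sum>j\<in>P. F (fst i) (snd i) (fst j) (snd j)) = (\<Sum>n\<in>S. \<Sum>x<n. \<Sum>m\<in>S. \<Sum>y<m. F n x m y)"
      using sumP[of "\<lambda>n x. \<Sum>j\<in>P. F n x (fst j) (snd j)"] sumP[of "F _ _"] by simp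
    also have "\<dots> = (\<Sum>n\<in>S. \<Sum>m\<in>S. \<Sum>x<n. \<Sum>y<m. F n x m y)"
      by (intro sum.cong refl sum.swap)
    finally show ?thesis unfolding F_def .
  qed
  also have "\<dots> \<le> (\<Sum>n\<in>S. \<Sum>m\<in>S. 8 * ((real n * \<rho> n) * (real m * \<rho> m)) + 2 * (real (gcd n m) * min (\<rho> n) (\<rho> m)))"
  proof (intro sum_mono)
    fix n m assume nm: "n \<in> S" "m \<in> S"
    let ?Q = "{(x, y). x < n \<and> y < m \<and> \<bar>(real x + g) / real n - (real y + g) / real m\<bar> \<le> \<rho> n + \<rho> m}"
    have Q: "?Q = {xy \<in> {..<n} \<times> {..<m}. \<bar>(real (fst xy) + g) / real n - (real (snd xy) + g) / real m\<bar> \<le> \<rho> n + \<rho> m}"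
      by auto
    have "(\<Sum>x<n. \<Sum>y<m. if \<bar>(real x + g) / real n - (real y + g) / real m\<bar> \<le> \<rho> n + \<rho> m
        then 2 * min (\<rho> n) (\<rho> m) else 0) = real (card ?Q) * (2 * min (\<rho> n) (\<rho> m))"
      unfolding Q sum.cartesian_product case_prod_beta
      by (subst sum.inter_filter[symmetric]) auto
    also have "\<dots> \<le> (2 * real n * real m * (\<rho> n + \<rho> m) + real (gcd n m)) * (2 * min (\<rho> n) (\<rho> m))"
      using nm posS \<rho> by (intro mult_right_mono card_close_fractions) (auto simp: add_nonneg_nonneg)
    also have "\<dots> = 4 * (real n * real m) * ((\<rho> n + \<rho> m) * min (\<rho> n) (\<rho> m)) + 2 * (real (gcd n m) * min (\<rho> n) (\<rho> m))"
      by (simp add: algebra_simps)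
    also have "\<dots> \<le> 4 * (real n * real m) * (2 * (\<rho> n * \<rho> m)) + 2 * (real (gcd n m) * min (\<rho> n) (\<rho> m))"
    proof -
      have "(\<rho> n + \<rho> m) * min (\<rho> n) (\<rho> m) \<le> 2 * (\<rho> n * \<rho> m)"
        using \<rho>[OF nm(1)] \<rho>[OF nm(2)] by (auto simp: min_def algebra_simps mult_left_mono mult_right_mono)
      then show ?thesis by (intro add_right_mono mult_left_mono) auto
    qed
    finally show "(\<Sum>x<n. \<Sum>y<m. if \<bar>(real x + g) / real n - (real y + g) / real m\<bar> \<le> \<rho> n + \<rho> m
        then 2 * min (\<rho> n) (\<rho> m) else 0) \<le> 8 * ((real n * \<rho> n) * (real m * \<rho> m)) + 2 * (real (gcd n m) * min (\<rho> n) (\<rho> m))"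
      by (simp add: algebra_simps)
  qed
  also have "\<dots> = 8 * (\<Sum>n\<in>S. real n * \<rho> n)\<^sup>2 + 2 * (\<Sum>n\<in>S. \<Sum>m\<in>S. real (gcd n m) * min (\<rho> n) (\<rho> m))"
    unfolding power2_eq_square sum_product by (simp add: sum.distrib sum_distrib_left)
  \<comment> \<open>The minimum is replaced by the radius of the larger index, so that the gcd will
    be divided by the larger of n and m; the diagonal is counted twice.\<close>
  also have "(\<Sum>n\<in>S. \<Sum>m\<in>S. real (gcd n m) * min (\<rho> n) (\<rho> m))
      \<le> (\<Sum>n\<in>S. \<Sum>m\<in>S. (if n \<le> m then real (gcd n m) * \<rho> m else 0) + (if m \<le> n then real (gcd n m) * \<rho> n else 0))"
    using \<rho> by (intro sum_mono) (auto simp: min_def mult_left_mono intro: order_trans)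
  also have "\<dots> = 2 * (\<Sum>m\<in>S. \<Sum>n\<in>S. if n \<le> m then real (gcd n m) * \<rho> m else 0)"
  proof -
    have "(\<Sum>n\<in>S. \<Sum>m\<in>S. if m \<le> n then real (gcd n m) * \<rho> n else 0)
        = (\<Sum>m\<in>S. \<Sum>n\<in>S. if n \<le> m then real (gcd n m) * \<rho> m else 0)"
      by (intro sum.cong refl) (simp add: gcd.commute)
    then show ?thesis
      unfolding sum.distrib by (subst sum.swap) simp
  qed
  also have "\<dots> = 2 * (\<Sum>m\<in>S. \<Sum>n\<in>{n \<in> S. n \<le> m}. real (gcd n m) * \<rho> m)"
    by (simp add: sum.inter_filter[OF finS])
  finally show "(\<integral>z. (fraction_balls S \<rho> g z)\<^sup>2 \<partial>lebesgue) \<le> 8 * (\<Sum>n\<in>S. real n * \<rho> n)\<^sup>2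
      + 4 * (\<Sum>m\<in>S. \<Sum>n\<in>{n \<in> S. n \<le> m}. real (gcd n m) * \<rho> m)"
    by simp
qed

text \<open>Only balls lying entirely in the interval are kept. At least n (v - u) - 2 centres
  qualify, which is at least half of n (v - u) by \<open>large\<close>; the lost factor 2 is
  recovered from the diameter 2 * \<rho> n.\<close>

lemma fraction_balls_local_mass:
  assumes g: "0 \<le> g" "g < 1" and uv: "0 \<le> u" "v \<le> 1"
    and small: "\<And>n. n \<in> S \<Longrightarrow> real n * \<rho> n \<le> 1 / 2"
    and large: "\<And>n. n \<in> S \<Longrightarrow> 4 \<le> real n * (v - u)"
  shows "(v - u) * (\<Sum>n\<in>S. real n * \<rho> n) \<le> (\<integral>z. indicator {u..<v} z * fraction_balls S \<rho> g z \<partial>lebesgue)"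
proof -
  define c where "c n x = (real x + g) / real n" for n x :: nat
  define X where "X n = {x. x < n \<and> u \<le> c n x - \<rho> n \<and> c n x + \<rho> n < v}" for n
  have finX: "finite (X n)" for n by (simp add: X_def)
  have cardX: "real n * (v - u) - 2 \<le> real (card (X n))" if n: "n \<in> S" for n
  proof -
    have n0: "real n > 0" using posS[OF n] by simp
    define A where "A = real n * u + real n * \<rho> n - g"
    define B where "B = real n * v - real n * \<rho> n - g"
    have nr: "0 \<le> real n * \<rho> n" using \<rho>[OF n] by simp
    \<comment> \<open>Here g < 1 is used: every integer from A on is nonnegative, so
      \<open>nat\<close> is injective on them. The next line uses g \<ge> 0 to get x < n.\<close>
    have A: "A > -1" using mult_nonneg_nonneg[OF of_nat_0_le_iff uv(1), of n] g nr unfolding A_def by linarith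
    have Bn: "B \<le> real n" using mult_left_le[of v "real n"] uv g nr unfolding B_def by simp
    have "nat ` {\<lceil>A\<rceil>..<\<lceil>B\<rceil>} \<subseteq> X n"
    proof
      fix x assume "x \<in> nat ` {\<lceil>A\<rceil>..<\<lceil>B\<rceil>}"
      then obtain z where z: "x = nat z" "\<lceil>A\<rceil> \<le> z" "z < \<lceil>B\<rceil>" by auto
      have "A \<le> z" "z < B" using z by (auto simp: ceiling_le_iff less_ceiling_iff)
      moreover have "z \<ge> 0" using A \<open>A \<le> z\<close> by linarith
      ultimately have x: "A \<le> real x" "real x < B" using z by auto
      have "x < n" using x Bn by simp
      moreover have "u + \<rho> n \<le> c n x" "c n x < v - \<rho> n"
        using x n0 by (auto simp: A_def B_def c_def field_simps)
      ultimately show "x \<in> X n" by (simp add: X_def)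
    qed
    then have "card (nat ` {\<lceil>A\<rceil>..<\<lceil>B\<rceil>}) \<le> card (X n)"
      using finX by (intro card_mono) auto
    moreover have "inj_on nat {\<lceil>A\<rceil>..<\<lceil>B\<rceil>}"
    proof -
      have "0 \<le> \<lceil>A\<rceil>" using A by simp
      then have "\<And>z. z \<in> {\<lceil>A\<rceil>..<\<lceil>B\<rceil>} \<Longrightarrow> 0 \<le> z"
        by (meson atLeastLessThan_iff order_trans)
      then show ?thesis by (metis inj_onI nat_0_le)
    qed
    ultimately have "nat (\<lceil>B\<rceil> - \<lceil>A\<rceil>) \<le> card (X n)"
      by (simp add: card_image)
    then have "B - A - 1 \<le> real (card (X n))" by linarith
    moreover have "B - A = real n * (v - u) - 2 * (real n * \<rho> n)"
      by (simp add: A_def B_def algebra_simps)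
    ultimately show ?thesis using small[OF n] by linarith
  qed
  have sub: "(SIGMA n:S. X n) \<subseteq> (SIGMA n:S. {..<n})" by (auto simp: X_def)
  have "(v - u) * (\<Sum>n\<in>S. real n * \<rho> n) = (\<Sum>n\<in>S. (real n * (v - u)) * \<rho> n)"
    by (simp add: sum_distrib_left algebra_simps)
  also have "\<dots> \<le> (\<Sum>n\<in>S. real (card (X n)) * (2 * \<rho> n))"
  proof (intro sum_mono)
    fix n assume n: "n \<in> S"
    have "real n * (v - u) \<le> 2 * real (card (X n))"
      using cardX[OF n] large[OF n] by linarith
    then have "real n * (v - u) * \<rho> n \<le> 2 * real (card (X n)) * \<rho> n"
      using \<rho>[OF n] by (rule mult_right_mono)
    then show "real n * (v - u) * \<rho> n \<le> real (card (X n)) * (2 * \<rho> n)" by simp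
  qed
  also have "\<dots> = (\<Sum>(n, x)\<in>(SIGMA n:S. X n). 2 * \<rho> n)"
    using finS finX by (simp add: sum.Sigma[symmetric])
  also have "\<dots> = (\<Sum>(n, x)\<in>(SIGMA n:S. X n). (\<integral>z. indicator (cball (c n x) (\<rho> n)) z \<partial>lebesgue))"
    by (intro sum.cong refl) (auto simp: cball_eq_atLeastAtMost \<rho>)
  also have "\<dots> = (\<integral>z. (\<Sum>(n, x)\<in>(SIGMA n:S. X n). indicator (cball (c n x) (\<rho> n)) z) \<partial>lebesgue)"
    unfolding case_prod_beta
    by (intro Bochner_Integration.integral_sum[symmetric] integrable_cball_indicator)
  also have "\<dots> \<le> (\<integral>z. indicator {u..<v} z * fraction_balls S \<rho> g z \<partial>lebesgue)"
  proof (rule integral_mono)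
    show "integrable lebesgue (\<lambda>z. \<Sum>(n, x)\<in>(SIGMA n:S. X n). indicat_real (cball (c n x) (\<rho> n)) z)"
      unfolding case_prod_beta by (intro Bochner_Integration.integrable_sum integrable_cball_indicator)
    show "integrable lebesgue (\<lambda>z. indicator {u..<v} z * fraction_balls S \<rho> g z)"
      using integrable_mult_indicator[OF _ fraction_balls_integrable, of "{u..<v}"] by simp
    fix z
    have "(\<Sum>(n, x)\<in>(SIGMA n:S. X n). indicat_real (cball (c n x) (\<rho> n)) z)
        = (\<Sum>(n, x)\<in>(SIGMA n:S. X n). indicator {u..<v} z * indicat_real (cball (c n x) (\<rho> n)) z)"
      by (intro sum.cong refl) (auto simp: X_def indicator_def dist_real_def abs_le_iff)
    also have "\<dots> = indicator {u..<v} z * (\<Sum>(n, x)\<in>(SIGMA n:S. X n). indicat_real (cball (c n x) (\<rho> n)) z)"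
      by (simp add: sum_distrib_left case_prod_beta)
    also have "\<dots> \<le> indicator {u..<v} z * fraction_balls S \<rho> g z"
      unfolding fraction_balls_def c_def
      by (intro mult_left_mono sum_mono2) (use finS sub[unfolded X_def c_def] in \<open>auto simp: X_def c_def\<close>)
    finally show "(\<Sum>(n, x)\<in>(SIGMA n:S. X n). indicat_real (cball (c n x) (\<rho> n)) z)
        \<le> indicator {u..<v} z * fraction_balls S \<rho> g z" .
  qed
  finally show ?thesis .
qed

end

section \<open>Weights attached to a good rational approximation\<close>

lemma sum_le_inj:
  fixes f :: "'a \<Rightarrow> real" and g :: "'b \<Rightarrow> real"
  assumes "finite B" "inj_on h A" "h ` A \<subseteq> B"
    and "\<And>x. x \<in> A \<Longrightarrow> f x \<le> g (h x)" "\<And>y. y \<in> B \<Longrightarrow> 0 \<le> g y"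
  shows "sum f A \<le> sum g B"
proof -
  have "sum f A \<le> (\<Sum>x\<in>A. g (h x))" using assms(4) by (rule sum_mono)
  also have "\<dots> = sum g (h ` A)" using assms(2) by (simp add: sum.reindex)
  also have "\<dots> \<le> sum g B" using assms by (intro sum_mono2) auto
  finally show ?thesis .
qed

lemma harm_le_ln:
  assumes "n \<ge> 1"
  shows "harm n \<le> 1 + ln (real n)"
proof -
  obtain k where k: "n = Suc k" using assms by (cases n) auto
  have "harm (Suc k) - ln (real (Suc k)) \<le> harm (Suc 0) - ln (real (Suc 0))"
    using decseq_harm_diff_ln unfolding decseq_def by blast
  then show ?thesis using k by (simp add: harm_expand)
qed

lemma harm_eq_sum: "harm n = (\<Sum>k\<in>{1..n}. 1 / real k)"
  by (simp add: harm_def inverse_eq_divide)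

lemma inj_on_div_of_congruent:
  fixes A :: "nat set"
  assumes "\<And>x y. x \<in> A \<Longrightarrow> y \<in> A \<Longrightarrow> x mod Q = y mod Q"
  shows "inj_on (\<lambda>x. x div Q) A"
  using assms by (intro inj_onI) (metis div_mult_mod_eq)

lemma card_congruent_le:
  fixes A :: "nat set"
  assumes "\<And>x y. x \<in> A \<Longrightarrow> y \<in> A \<Longrightarrow> x mod Q = y mod Q" and "\<And>x. x \<in> A \<Longrightarrow> x \<le> N"
  shows "card A \<le> N div Q + 1"
proof -
  have "card A \<le> card {0..N div Q}"
    using assms(2) by (intro card_inj_on_le[OF inj_on_div_of_congruent[OF assms(1)]]) (auto simp: div_le_mono)
  then show ?thesis by simp
qed

text \<open>Within one class modulo Q the quotients x div Q are distinct. Quotient 0 occurs at most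
  once and costs 1 / L; all other x satisfy x \<ge> Q * (x div Q) and give a harmonic sum divided by
  Q.\<close>

lemma sum_inverse_congruent_le:
  fixes A :: "nat set" and L :: real
  assumes cong: "\<And>x y. x \<in> A \<Longrightarrow> y \<in> A \<Longrightarrow> x mod Q = y mod Q" and "Q > 0" "L > 0"
    and L: "\<And>x. x \<in> A \<Longrightarrow> L \<le> real x" and R: "\<And>x. x \<in> A \<Longrightarrow> x \<le> R"
  shows "(\<Sum>x\<in>A. 1 / real x) \<le> 1 / L + harm R / real Q"
proof -
  have fin: "finite A" using R by (meson finite_nat_set_iff_bounded_le)
  define A0 where "A0 = {x \<in> A. x div Q = 0}"
  have inj: "inj_on (\<lambda>x. x div Q) A" by (rule inj_on_div_of_congruent[OF cong])
  have "card A0 \<le> card {0::nat}"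
    by (rule card_inj_on_le[OF inj_on_subset[OF inj]]) (auto simp: A0_def)
  then have c0: "real (card A0) \<le> 1" by simp
  have "(\<Sum>x\<in>A0. 1 / real x) \<le> (\<Sum>x\<in>A0. 1 / L)"
    using \<open>L > 0\<close> by (intro sum_mono frac_le) (auto simp: A0_def L)
  also have "\<dots> \<le> 1 / L"
    using c0 \<open>L > 0\<close> by (simp add: divide_right_mono)
  finally have 1: "(\<Sum>x\<in>A0. 1 / real x) \<le> 1 / L" .
  have "(\<Sum>x\<in>A - A0. 1 / real x) \<le> (\<Sum>k\<in>{1..R}. 1 / (real Q * real k))"
  proof (rule sum_le_inj[where h = "\<lambda>x. x div Q"])
    show "inj_on (\<lambda>x. x div Q) (A - A0)" using inj by (rule inj_on_subset) auto
    show "(\<lambda>x. x div Q) ` (A - A0) \<subseteq> {1..R}"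
      using R by (auto simp: A0_def Suc_le_eq) (meson R div_le_dividend order_trans)
    fix x assume x: "x \<in> A - A0"
    then have "x div Q > 0" by (auto simp: A0_def)
    moreover have "real Q * real (x div Q) \<le> real x"
      by (metis of_nat_le_iff of_nat_mult times_div_less_eq_dividend)
    ultimately show "1 / real x \<le> 1 / (real Q * real (x div Q))"
      using \<open>Q > 0\<close> by (intro divide_left_mono) (auto intro!: mult_pos_pos dest: order_less_le_trans[rotated])
  qed auto
  also have "\<dots> = harm R / real Q"
    unfolding harm_eq_sum sum_divide_distrib by (intro sum.cong) auto
  finally have 2: "(\<Sum>x\<in>A - A0. 1 / real x) \<le> harm R / real Q" .
  have "(\<Sum>x\<in>A. 1 / real x) = (\<Sum>x\<in>A - A0. 1 / real x) + (\<Sum>x\<in>A0. 1 / real x)"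
    using fin by (intro sum.subset_diff) (auto simp: A0_def)
  then show ?thesis using 1 2 by simp
qed

lemma sum_inverse_squares_le: "(\<Sum>b\<in>{1..n}. 1 / (real b)\<^sup>2) \<le> 2"
proof -
  have "n \<ge> 1 \<Longrightarrow> (\<Sum>b\<in>{1..n}. 1 / (real b)\<^sup>2) \<le> 2 - 1 / real n"
  proof (induction n rule: nat_induct_at_least)
    case base then show ?case by simp
  next
    case (Suc n)
    have "1 / (real (Suc n))\<^sup>2 \<le> 1 / (real n * real (Suc n))"
      using Suc.hyps by (intro divide_left_mono) (auto simp: power2_eq_square)
    also have "\<dots> = 1 / real n - 1 / real (Suc n)"
      using Suc.hyps by (simp add: field_simps)
    finally show ?case using Suc.IH by simp
  qed
  then show ?thesis by (cases "n \<ge> 1") (auto intro: order_trans)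
qed

text \<open>The product of three numbers is their lcm times overlaps. The lcm of the gcds divides q.
  The first overlap divides x - y; the second, between the third gcd and the lcm of the other two,
  splits into a divisor of x - z and one of y - z.\<close>

lemma three_gcds_dvd:
  fixes x y z q :: int
  shows "gcd x q * gcd y q * gcd z q dvd q * (x - y) * (x - z) * (y - z)"
proof -
  define l where "l = lcm (gcd x q) (gcd y q)"
  define h where "h = gcd l (gcd z q)"
  have 1: "gcd (gcd x q) (gcd y q) dvd x - y"
    by (intro dvd_diff) (auto intro: dvd_trans[OF gcd_dvd1] dvd_trans[OF gcd_dvd2])
  have "h dvd gcd x q * gcd y q"
    unfolding h_def l_def by (rule dvd_trans[OF gcd_dvd1 lcm_least]) simp_all
  then obtain h1 h2 where h: "h = h1 * h2" "h1 dvd gcd x q" "h2 dvd gcd y q"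
    using division_decomp by blast
  have "h dvd z" unfolding h_def by (rule dvd_trans[OF gcd_dvd2 gcd_dvd1])
  then have "h1 dvd z" "h2 dvd z" unfolding h(1) by (auto dest: dvd_mult_left dvd_mult_right)
  moreover have "h1 dvd x" "h2 dvd y"
    using h(2,3) by auto
  ultimately have "h1 dvd x - z" "h2 dvd y - z"
    by (auto intro: dvd_diff)
  then have 2: "h dvd (x - z) * (y - z)" unfolding h(1) by (rule mult_dvd_mono)
  have 3: "lcm l (gcd z q) dvd q" unfolding l_def by (intro lcm_least) auto
  have "gcd x q * gcd y q = gcd (gcd x q) (gcd y q) * l"
    unfolding l_def by (simp add: prod_gcd_lcm_int)
  moreover have "l * gcd z q = h * lcm l (gcd z q)"
    using prod_gcd_lcm_int[of l "gcd z q"] unfolding h_def l_def by simp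
  ultimately have "gcd x q * gcd y q * gcd z q = lcm l (gcd z q) * gcd (gcd x q) (gcd y q) * h"
    by (simp add: ac_simps)
  also have "\<dots> dvd q * (x - y) * ((x - z) * (y - z))"
    using 1 2 3 by (intro mult_dvd_mono)
  finally show ?thesis by (simp add: mult.assoc)
qed

text \<open>How the exponents fit: residues below K^2 and gcds up to K^14 lose a factor K^16 twice
  in the far pairs, so q has to be at least K^32. Three gcds above K^14 have a product above K^42,
  whereas \<open>three_gcds_dvd\<close> allows at most q * K^6 \<le> K^39. The gap between 32 and 33
  leaves room for K to be an integer.\<close>

locale close_fraction =
  fixes p c :: int and q K :: nat
  assumes coprime_pq: "coprime p (int q)"
    and K_large: "ln (real K) \<ge> 4"
    and K_le: "K ^ 32 \<le> q" and q_le: "q \<le> K ^ 33"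
begin

text \<open>If p / q is close to \<open>\<alpha>\<close> and c is the floor of \<open>q * \<gamma>\<close>, then the distance of \<open>n * \<alpha> - \<gamma>\<close> to the
  integers is at most about \<open>residue n / q\<close>.\<close>

definition residue :: "nat \<Rightarrow> nat"
  where "residue n = nat ((int n * p - c) mod int q)"

text \<open>The bound n < q^3 keeps n times the error of q * \<alpha> - p at most 1. The bound n
  \<ge> q^2 forces d \<ge> q whenever n = b * d with b \<le> q. The gcd bound is inherited by
  divisors d of n and keeps the multiples of d with a prescribed residue sparse.\<close>

definition good :: "nat set"
  where "good = {n. q ^ 2 \<le> n \<and> n < q ^ 3 \<and> K \<le> residue n \<and> residue n < K ^ 2 \<and> gcd n q \<le> K ^ 14}"

text \<open>Reciprocal of n times the approximate distance residue n / q. Scaled by a constant over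
  lam^2 it becomes n times the radius of the balls.\<close>

definition weight :: "nat \<Rightarrow> real"
  where "weight n = real q / (real n * real (residue n))"

abbreviation lam :: real
  where "lam \<equiv> ln (real K)"

lemma K_ge: "K \<ge> 5"
proof (rule ccontr)
  assume "\<not> K \<ge> 5"
  then have "real K \<le> 4" by simp
  moreover have "real K > 0" using K_large by (cases "K = 0") auto
  ultimately have "ln (real K) \<le> real K - 1" by (intro ln_le_minus_one) auto
  then show False using K_large \<open>real K \<le> 4\<close> by linarith
qed

lemma K2_le: "K ^ 2 \<le> q"
proof -
  have "K ^ 2 \<le> K ^ 32" using K_ge by (intro power_increasing) auto
  then show ?thesis using K_le by (rule order_trans)
qed

lemma q_pos: "q > 0"
  using K_ge K2_le by (cases "q = 0") auto

lemma ln_q: "32 * lam \<le> ln (real q)" "ln (real q) \<le> 33 * lam"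
proof -
  have K0: "real K > 0" using K_ge by simp
  have "32 * lam = ln (real (K ^ 32))" using K0 by (simp add: ln_realpow)
  also have "\<dots> \<le> ln (real q)" using K_le K0 q_pos by (subst ln_le_cancel_iff) (auto simp flip: of_nat_power)
  finally show "32 * lam \<le> ln (real q)" .
  have "ln (real q) \<le> ln (real (K ^ 33))" using q_le K0 q_pos by (subst ln_le_cancel_iff) (auto simp flip: of_nat_power)
  then show "ln (real q) \<le> 33 * lam" using K0 by (simp add: ln_realpow)
qed

lemma harm_q: "harm (q ^ i) \<le> (33 * real i + 1) * lam"
proof -
  have "harm (q ^ i) \<le> 1 + real i * ln (real q)"
    using harm_le_ln[of "q ^ i"] q_pos by (simp add: ln_realpow)
  also have "\<dots> \<le> lam + real i * (33 * lam)"
    using K_large ln_q(2) by (intro add_mono mult_left_mono) auto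
  finally show ?thesis by (simp add: algebra_simps)
qed

lemma finite_good: "finite good"
  unfolding good_def by (rule finite_subset[of _ "{..<q ^ 3}"]) auto

lemma residue_dvd: "int q dvd int n * p - c - int (residue n)"
  using q_pos unfolding residue_def by (simp add: mod_eq_dvd_iff[symmetric])

lemma residue_unique:
  assumes "int q dvd int n * p - c - int t" "t < q"
  shows "residue n = t"
proof -
  have "(int n * p - c) mod int q = int t mod int q"
    using assms(1) by (simp add: mod_eq_dvd_iff)
  then show ?thesis using assms(2) by (simp add: residue_def)
qed

text \<open>As p is invertible modulo q, the gcd of n with q depends only on the residue of n, so
  excluding large gcds removes whole residues t.\<close>

lemma gcd_residue: "gcd (int n) (int q) = gcd (c + int (residue n)) (int q)"
proof -
  have "gcd (int n) (int q) = gcd (int n * p) (int q)"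
    using coprime_pq by (intro gcd_mult_left_right_cancel[symmetric]) (simp add: coprime_commute)
  also have "\<dots> = gcd (c + int (residue n)) (int q)"
  proof -
    have "(int n * p) mod int q = (c + int (residue n)) mod int q"
      using residue_dvd[of n] by (simp add: mod_eq_dvd_iff diff_diff_eq)
    then show ?thesis by (metis gcd.commute gcd_red_int)
  qed
  finally show ?thesis .
qed

lemma good_pos: "n \<in> good \<Longrightarrow> n > 0"
  using q_pos by (auto simp: good_def intro: less_le_trans[of 0 "q ^ 2"])

lemma residue_pos: "n \<in> good \<Longrightarrow> residue n \<ge> 1"
  using K_ge by (auto simp: good_def)

lemma weight_nonneg: "weight n \<ge> 0"
  by (simp add: weight_def)

lemma dvd_p_cancel:
  assumes "int q dvd k * p" shows "int q dvd k"
  using assms coprime_pq by (simp add: coprime_commute coprime_dvd_mult_left_iff)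

section \<open>The total weight from below\<close>

text \<open>Three such residues would give three divisors of q, each larger than \<open>K ^ 14\<close>, with
  pairwise gcds at most \<open>K ^ 2\<close>, so that their lcm would exceed q.\<close>

lemma card_bad_residues: "card {t \<in> {K..<K ^ 2}. \<not> gcd (c + int t) (int q) \<le> int (K ^ 14)} \<le> 2"
proof (rule ccontr)
  define B where "B = {t \<in> {K..<K ^ 2}. \<not> gcd (c + int t) (int q) \<le> int (K ^ 14)}"
  assume "\<not> card {t \<in> {K..<K ^ 2}. \<not> gcd (c + int t) (int q) \<le> int (K ^ 14)} \<le> 2"
  then have "3 \<le> card B" by (simp add: B_def)
  then obtain C where "C \<subseteq> B" "card C = 3"
    by (meson obtain_subset_with_card_n)
  then obtain r s t where rst: "r \<in> B" "s \<in> B" "t \<in> B" "r \<noteq> s" "r \<noteq> t" "s \<noteq> t"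
    by (auto simp: card_3_iff)
  define g where "g u = gcd (c + int u) (int q)" for u
  have g: "int (K ^ 14) \<le> g u" if "u \<in> B" for u
    using that by (auto simp: B_def g_def)
  have "g r * g s * g t dvd int q * ((c + int r) - (c + int s)) * ((c + int r) - (c + int t)) * ((c + int s) - (c + int t))"
    unfolding g_def by (rule three_gcds_dvd)
  then have "g r * g s * g t dvd int q * (int r - int s) * (int r - int t) * (int s - int t)"
    by simp
  then have "\<bar>g r * g s * g t\<bar> \<le> \<bar>int q * (int r - int s) * (int r - int t) * (int s - int t)\<bar>"
    using rst q_pos by (intro dvd_imp_le_int) auto
  also have "\<dots> = int q * \<bar>int r - int s\<bar> * \<bar>int r - int t\<bar> * \<bar>int s - int t\<bar>"
    by (simp add: abs_mult)
  also have "\<dots> \<le> int (K ^ 33) * int (K ^ 2) * int (K ^ 2) * int (K ^ 2)"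
  proof -
    have d: "\<bar>int u - int v\<bar> \<le> int (K ^ 2)" if "u \<in> B" "v \<in> B" for u v
    proof -
      have "u < K ^ 2" "v < K ^ 2" using that by (auto simp: B_def)
      then show ?thesis by linarith
    qed
    have "int q \<le> int (K ^ 33)" using q_le by (rule of_nat_mono)
    then show ?thesis using d rst by (intro mult_mono) auto
  qed
  also have "\<dots> = int (K ^ 39)" by (simp flip: power_add)
  also have "\<dots> < int (K ^ 42)"
    using K_ge by (intro of_nat_less_iff[THEN iffD2] power_strict_increasing) auto
  also have "\<dots> = int (K ^ 14) * int (K ^ 14) * int (K ^ 14)" by (simp flip: power_add)
  also have "\<dots> \<le> g r * g s * g t"
    using g rst by (intro mult_mono) (auto simp: g_def)
  also have "\<dots> \<le> \<bar>g r * g s * g t\<bar>" by simp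
  finally show False by simp
qed

text \<open>A residue t and a block k determine n = r t + q * k. Since n < q * (k + 1), its weight
  is at least 1 / (t * (k + 1)), and the double sum factors. The blocks q \<le> k < q^2 fill the
  range q^2 \<le> n < q^3.\<close>

lemma sum_weight_ge: "lam\<^sup>2 \<le> (\<Sum>n\<in>good. weight n)"
proof -
  define T where "T = {t \<in> {K..<K ^ 2}. gcd (c + int t) (int q) \<le> int (K ^ 14)}"
  define B where "B = {t \<in> {K..<K ^ 2}. \<not> gcd (c + int t) (int q) \<le> int (K ^ 14)}"
  have "\<exists>r. r < q \<and> int q dvd int r * p - c - int t" for t
  proof -
    \<comment> \<open>The inverse u of p modulo q solves r * p = c + t modulo q.\<close>
    obtain u v where uv: "u * p + v * int q = 1"
      using bezout_int[of p "int q"] coprime_pq by auto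
    define r where "r = nat ((u * (c + int t)) mod int q)"
    have "int q dvd u * (c + int t) - int r"
      using q_pos unfolding r_def by (simp add: mod_eq_dvd_iff[symmetric])
    then have "int q dvd (u * (c + int t) - int r) * p" by simp
    moreover have "int q dvd (c + int t) * (v * int q)" by simp
    ultimately have "int q dvd - ((u * (c + int t) - int r) * p) - (c + int t) * (v * int q)"
      by (intro dvd_diff) (auto simp: dvd_minus_iff)
    moreover have "- ((u * (c + int t) - int r) * p) - (c + int t) * (v * int q)
        = int r * p - (c + int t) * (u * p + v * int q)"
      by (simp add: algebra_simps)
    ultimately have "int q dvd int r * p - c - int t"
      using uv by (simp add: diff_diff_eq)
    moreover have "r < q" using q_pos unfolding r_def by (simp add: nat_less_iff)
    ultimately show ?thesis by blast
  qed
  then obtain r where r: "\<And>t. r t < q" "\<And>t. int q dvd int (r t) * p - c - int t"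
    by metis
  have res: "residue (r t + q * k) = t" if "t < K ^ 2" for t k
  proof (rule residue_unique)
    have "int q dvd (int (r t) * p - c - int t) + int q * (int k * p)" using r(2) by simp
    then show "int q dvd int (r t + q * k) * p - c - int t" by (simp add: algebra_simps)
    show "t < q" using that K2_le by simp
  qed
  have "(\<Sum>(t, k)\<in>T \<times> {q..<q ^ 2}. 1 / real t * (1 / real (k + 1))) \<le> (\<Sum>n\<in>good. weight n)"
  proof (rule sum_le_inj[where h = "\<lambda>(t, k). r t + q * k"])
    show "inj_on (\<lambda>(t, k). r t + q * k) (T \<times> {q..<q ^ 2})"
    proof (rule inj_onI, clarify)
      fix t k t' k' assume "t \<in> T" "t' \<in> T" and eq: "r t + q * k = r t' + q * k'"
      then have "t = t'" using res[of t k] res[of t' k'] by (auto simp: T_def)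
      moreover then have "k = k'" using eq q_pos by simp
      ultimately show "t = t' \<and> k = k'" by simp
    qed
    show "(\<lambda>(t, k). r t + q * k) ` (T \<times> {q..<q ^ 2}) \<subseteq> good"
    proof clarify
      fix t k assume t: "t \<in> T" and k: "k \<in> {q..<q ^ 2}"
      have "q ^ 2 \<le> q * k" using k by (simp add: power2_eq_square)
      then have 1: "q ^ 2 \<le> r t + q * k" by simp
      have "r t + q * k < q * (k + 1)" using r(1)[of t] by simp
      also have "\<dots> \<le> q * q ^ 2" using k by (intro mult_le_mono) auto
      finally have 2: "r t + q * k < q ^ 3" by (simp add: power3_eq_cube power2_eq_square)
      have rt: "residue (r t + q * k) = t" using res t by (simp add: T_def)
      have "int (gcd (r t + q * k) q) \<le> int (K ^ 14)"
        using gcd_residue[of "r t + q * k"] t unfolding rt by (simp add: T_def flip: gcd_int_int_eq)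
      then show "r t + q * k \<in> good"
        using 1 2 rt t by (auto simp: good_def T_def)
    qed
    show "(case x of (t, k) \<Rightarrow> 1 / real t * (1 / real (k + 1))) \<le> weight (case x of (t, k) \<Rightarrow> r t + q * k)"
      if "x \<in> T \<times> {q..<q ^ 2}" for x
    proof -
      obtain t k where x: "x = (t, k)" "t \<in> T" "q \<le> k" using \<open>x \<in> _\<close> by auto
      have t: "t > 0" "residue (r t + q * k) = t"
        using x K_ge res by (auto simp: T_def)
      have "real (r t + q * k) \<le> real (q * (k + 1))"
        using r(1)[of t] by (intro of_nat_mono) simp
      moreover have "r t + q * k > 0" using q_pos x(3) by (simp add: add_nonneg_pos)
      ultimately have "real q / (real (q * (k + 1)) * real t) \<le> real q / (real (r t + q * k) * real t)"
        using t by (intro frac_le mult_right_mono mult_pos_pos) (simp_all only: of_nat_0_le_iff of_nat_0_less_iff order_refl)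
      moreover have "real q / (real (q * (k + 1)) * real t) = 1 / real t * (1 / real (k + 1))"
        unfolding of_nat_mult using q_pos by (simp add: mult.assoc mult.commute del: of_nat_add of_nat_Suc)
      ultimately show ?thesis
        using x t by (simp add: weight_def)
    qed
  qed (auto simp: finite_good weight_nonneg)
  moreover have "(\<Sum>(t, k)\<in>T \<times> {q..<q ^ 2}. 1 / real t * (1 / real (k + 1)))
      = (\<Sum>t\<in>T. 1 / real t) * (\<Sum>k\<in>{q..<q ^ 2}. 1 / real (k + 1))"
    by (simp add: sum_product sum.cartesian_product)
  \<comment> \<open>The difference of the harmonic numbers is at least ln q - 1 \<ge> 32 * lam - 1,
    and lam \<ge> 4.\<close>
  moreover have "(\<Sum>k\<in>{q..<q ^ 2}. 1 / real (k + 1)) \<ge> 31 * lam"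
  proof -
    have "q \<le> q ^ 2" using q_pos by (simp add: power2_eq_square)
    have "(\<Sum>k\<in>{q..<q ^ 2}. 1 / real (k + 1)) = harm (q ^ 2) - harm q"
    proof -
      have "(\<Sum>k\<in>{q..<q ^ 2}. harm (Suc k) - harm k) = harm (q ^ 2) - (harm q :: real)"
        using \<open>q \<le> q ^ 2\<close> by (rule sum_Suc_diff')
      then show ?thesis by (simp add: harm_Suc inverse_eq_divide add.commute)
    qed
    moreover have "harm (q ^ 2) \<ge> 2 * ln (real q)"
    proof -
      have "2 * ln (real q) = ln (real (q ^ 2))" using q_pos by (simp add: ln_realpow)
      also have "\<dots> \<le> ln (real (q ^ 2) + 1)" using q_pos by (subst ln_le_cancel_iff) (auto intro: add_nonneg_pos)
      finally show ?thesis using harm_ge_ln[of "q ^ 2"] by simp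
    qed
    moreover have "harm q \<le> 1 + ln (real q)" using q_pos by (intro harm_le_ln) simp
    ultimately show ?thesis using ln_q(1) K_large by linarith
  qed
  \<comment> \<open>The full range gives at least 2 * lam - (1 + lam) and the bad residues cost at
    most 1; lam - 2 \<ge> lam / 4 since lam \<ge> 4. The range stops at K^2 - 1, but
    \<open>harm_ge_ln\<close> bounds harm (K^2 - 1) below by ln (K^2).\<close>
  moreover have "(\<Sum>t\<in>T. 1 / real t) \<ge> lam / 4"
  proof -
    have TB: "(\<Sum>t\<in>{K..<K ^ 2}. 1 / real t) = (\<Sum>t\<in>T. 1 / real t) + (\<Sum>t\<in>B. 1 / real t)"
    proof -
      have "{K..<K ^ 2} = T \<union> B" "T \<inter> B = {}" "finite T" "finite B"
        by (auto simp: T_def B_def)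
      then show ?thesis by (simp add: sum.union_disjoint)
    qed
    have "(\<Sum>t\<in>B. 1 / real t) \<le> (\<Sum>t\<in>B. 1 / real K)"
      using K_ge by (intro sum_mono divide_left_mono) (auto simp: B_def)
    also have "\<dots> \<le> 2 * (1 / real K)"
      using card_bad_residues unfolding B_def[symmetric] sum_constant
      by (intro mult_right_mono) auto
    also have "\<dots> \<le> 1" using K_ge by simp
    finally have B: "(\<Sum>t\<in>B. 1 / real t) \<le> 1" .
    have "K - 1 \<le> K ^ 2 - 1" using K_ge by (simp add: power2_eq_square diff_le_mono)
    then have "(\<Sum>k\<in>{K - 1..<K ^ 2 - 1}. harm (Suc k) - harm k) = harm (K ^ 2 - 1) - (harm (K - 1) :: real)"
      by (rule sum_Suc_diff')
    moreover have "(\<Sum>t\<in>{K..<K ^ 2}. 1 / real t) = (\<Sum>k\<in>{K - 1..<K ^ 2 - 1}. 1 / real (Suc k))"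
      using K_ge sum.shift_bounds_Suc_ivl[of "\<lambda>t. 1 / real t" "K - 1" "K ^ 2 - 1"] by simp
    ultimately have "(\<Sum>t\<in>{K..<K ^ 2}. 1 / real t) = harm (K ^ 2 - 1) - harm (K - 1)"
      by (simp add: harm_Suc inverse_eq_divide)
    moreover have "harm (K ^ 2 - 1) \<ge> 2 * lam"
    proof -
      have "real (K ^ 2 - 1) + 1 = real K ^ 2" using K_ge by (simp add: of_nat_diff)
      then have "ln (real (K ^ 2 - 1) + 1) = 2 * lam" using K_ge by (simp add: ln_realpow)
      then show ?thesis using harm_ge_ln[of "K ^ 2 - 1"] by simp
    qed
    moreover have "harm (K - 1) \<le> (harm K :: real)" by (rule harm_mono) simp
    moreover have "harm K \<le> 1 + lam" using K_ge by (intro harm_le_ln) simp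
    ultimately show ?thesis using TB B K_large by linarith
  qed
  moreover from calculation(3,4) have "lam / 4 * (31 * lam)
      \<le> (\<Sum>t\<in>T. 1 / real t) * (\<Sum>k\<in>{q..<q ^ 2}. 1 / real (k + 1))"
    using K_large by (intro mult_mono) (auto intro: sum_nonneg)
  ultimately have "lam / 4 * (31 * lam) \<le> (\<Sum>n\<in>good. weight n)"
    by linarith
  moreover have "lam\<^sup>2 \<le> lam / 4 * (31 * lam)"
    by (simp add: power2_eq_square)
  ultimately show ?thesis by linarith
qed

section \<open>Pairs with small b: rigidity of residues\<close>

lemma residue_diff_dvd: "int q dvd (int x - int y) * p - (int (residue x) - int (residue y))"
proof -
  \<comment> \<open>The difference eliminates c, and with it the shift
    \<open>\<gamma>\<^sub>1\<close>.\<close>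
  have "int q dvd (int x * p - c - int (residue x)) - (int y * p - c - int (residue y))"
    by (intro dvd_diff residue_dvd)
  then show ?thesis by (simp add: algebra_simps)
qed

lemma good_abs_residue_diff:
  assumes "x \<in> good" "y \<in> good"
  shows "\<bar>int (residue x) - int (residue y)\<bar> < int (K ^ 2)"
proof -
  have "residue x < K ^ 2" "residue y < K ^ 2" using assms by (auto simp: good_def)
  then show ?thesis by linarith
qed

text \<open>Both sides agree modulo q and are smaller than q / 2, so the congruence is an equality.\<close>

lemma residue_proportional:
  assumes ab: "0 < a" "a \<le> b" "2 * b * K ^ 2 \<le> q"
    and mem: "a * d \<in> good" "b * d \<in> good" "a * e \<in> good" "b * e \<in> good"
  shows "int a * (int (residue (b * d)) - int (residue (b * e))) = int b * (int (residue (a * d)) - int (residue (a * e)))"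
proof -
  define u where "u = int (residue (b * d)) - int (residue (b * e))"
  define v where "v = int (residue (a * d)) - int (residue (a * e))"
  have "int q dvd int b * ((int (a * d) - int (a * e)) * p - v) - int a * ((int (b * d) - int (b * e)) * p - u)"
    unfolding u_def v_def by (intro dvd_diff dvd_mult residue_diff_dvd)
  then have dvd: "int q dvd int a * u - int b * v" by (simp add: algebra_simps)
  have uv: "\<bar>u\<bar> < int (K ^ 2)" "\<bar>v\<bar> < int (K ^ 2)"
    unfolding u_def v_def using mem by (auto intro!: good_abs_residue_diff simp del: of_nat_power)
  have "\<bar>int a * u - int b * v\<bar> \<le> int a * \<bar>u\<bar> + int b * \<bar>v\<bar>"
    using abs_triangle_ineq4[of "int a * u" "int b * v"] by (simp add: abs_mult)
  also have "\<dots> < int b * int (K ^ 2) + int b * int (K ^ 2)"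
    using uv ab by (intro add_le_less_mono mult_mono mult_strict_left_mono) auto
  also have "\<dots> = int (2 * b * K ^ 2)" by simp
  also have "\<dots> \<le> int q" using ab(3) by (rule of_nat_mono)
  finally have "int a * u - int b * v = 0"
    using dvd by (metis dvd_imp_le_int abs_of_nat not_le)
  then show ?thesis unfolding u_def v_def by simp
qed

text \<open>By the proportionality, the residues of the b * d lie in a single class modulo b, and each of
  them determines d modulo q. This gains the factor b that makes the sum over all a and b converge.\<close>

lemma sum_weight_fixed_ratio:
  assumes ab: "0 < a" "a \<le> b" "2 * b * K ^ 2 \<le> q" "coprime a b"
  defines "D \<equiv> {d. a * d \<in> good \<and> b * d \<in> good}"
  shows "(\<Sum>d\<in>D. weight (b * d) / real b) \<le> 1 / (real b)\<^sup>2 * (1 / real K + 3 * lam / real b) * (67 * lam)"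
proof -
  have b0: "b > 0" using ab by simp
  have "b \<le> q" using ab(3) K_ge by (cases K) (auto simp: power2_eq_square)
  \<comment> \<open>From b \<le> q and b * d \<ge> q^2 every block number d div q is at least 1, as
    the sum of 1 / k requires.\<close>
  have d_ge: "q \<le> d" "d < q ^ 3" "b * d < q ^ 3" if "d \<in> D" for d
  proof -
    have bd: "q ^ 2 \<le> b * d" "b * d < q ^ 3" using that by (auto simp: D_def good_def)
    have "q * q \<le> q * d"
      using order_trans[OF bd(1) mult_le_mono1[OF \<open>b \<le> q\<close>, of d]] by (simp only: power2_eq_square)
    then show "q \<le> d" using q_pos by simp
    have "1 * d \<le> b * d" using b0 by (intro mult_le_mono1) simp
    then show "d < q ^ 3" using bd(2) by linarith
    show "b * d < q ^ 3" by fact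
  qed
  define T where "T = (\<lambda>d. residue (b * d)) ` D"
  have ratio: "int a * (int (residue (b * d)) - int (residue (b * e))) = int b * (int (residue (a * d)) - int (residue (a * e)))"
    if "d \<in> D" "e \<in> D" for d e
    using residue_proportional[OF ab(1-3)] that by (auto simp: D_def)
  have Tcong: "t mod b = s mod b" if ts: "t \<in> T" "s \<in> T" for t s
  proof -
    obtain d e where de: "d \<in> D" "e \<in> D" "t = residue (b * d)" "s = residue (b * e)"
      using ts by (auto simp: T_def)
    have "int b dvd int a * (int t - int s)"
      using ratio[OF de(1,2)] de(3,4) by simp
    then have "int b dvd int t - int s"
      using ab(4) by (simp add: coprime_commute coprime_dvd_mult_right_iff)
    then show ?thesis by (metis mod_eq_dvd_iff of_nat_eq_iff of_nat_mod)
  qed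
  \<comment> \<open>Equal residues of b * d and b * e force equal residues of a * d and a * e by
    proportionality; as a and b are coprime, q then divides d - e.\<close>
  have inj: "inj_on (\<lambda>d. (residue (b * d), d div q)) D"
  proof (rule inj_onI, clarify)
    fix d e assume de: "d \<in> D" "e \<in> D" and eq: "residue (b * d) = residue (b * e)" "d div q = e div q"
    have res_a: "residue (a * d) = residue (a * e)"
      using ratio[OF de] eq(1) b0 by simp
    have "int q dvd int a * ((int d - int e) * p)"
      using residue_diff_dvd[of "a * d" "a * e"] res_a by (simp add: algebra_simps)
    moreover have "int q dvd int b * ((int d - int e) * p)"
      using residue_diff_dvd[of "b * d" "b * e"] eq(1) by (simp add: algebra_simps)
    moreover obtain u v where uv: "u * int a + v * int b = 1"
      using bezout_int[of "int a" "int b"] ab(4) by auto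
    ultimately have "int q dvd u * (int a * ((int d - int e) * p)) + v * (int b * ((int d - int e) * p))"
      by (simp only: dvd_add dvd_mult)
    also have "\<dots> = (u * int a + v * int b) * ((int d - int e) * p)"
      by (simp only: ring_distribs mult.assoc)
    finally have "int q dvd (int d - int e) * p" unfolding uv by simp
    then have "int q dvd int d - int e" by (rule dvd_p_cancel)
    then have "d mod q = e mod q" by (metis mod_eq_dvd_iff of_nat_eq_iff of_nat_mod)
    then show "d = e" using eq(2) by (metis div_mult_mod_eq)
  qed
  have finD: "finite D" using d_ge(2) by (meson bounded_nat_set_is_finite)
  have finT: "finite T" using finD by (simp add: T_def)
  have sumT: "(\<Sum>t\<in>T. 1 / real t) \<le> 1 / real K + 3 * lam / real b"
  proof -
    have "(\<Sum>t\<in>T. 1 / real t) \<le> 1 / real K + harm (K ^ 2) / real b"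
    proof (rule sum_inverse_congruent_le[OF Tcong b0])
      show "real K > 0" using K_ge by simp
      show "real K \<le> real t" "t \<le> K ^ 2" if "t \<in> T" for t
        using that by (auto simp: T_def D_def good_def)
    qed
    moreover have "harm (K ^ 2) \<le> 3 * lam"
      using harm_le_ln[of "K ^ 2"] K_ge K_large by (simp add: ln_realpow)
    then have "harm (K ^ 2) / real b \<le> 3 * lam / real b" by (rule divide_right_mono) simp
    ultimately show ?thesis by linarith
  qed
  \<comment> \<open>One factor 1 / b is gcd / m, the other comes from m = b * d inside the weight; q
    cancels against d \<ge> q * (d div q). The 67 is 2 * 33 + 1 from \<open>harm_q\<close>.\<close>
  have "(\<Sum>d\<in>D. weight (b * d) / real b) \<le> (\<Sum>(t, k)\<in>T \<times> {1..q ^ 2}. 1 / (real b)\<^sup>2 * ((1 / real t) * (1 / real k)))"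
  proof (rule sum_le_inj[OF _ inj])
    show "(\<lambda>d. (residue (b * d), d div q)) ` D \<subseteq> T \<times> {1..q ^ 2}"
    proof clarify
      fix d assume d: "d \<in> D"
      have "1 \<le> d div q" using d_ge(1)[OF d] q_pos by (simp add: Suc_le_eq div_greater_zero_iff)
      moreover have "d < q * q ^ 2" using d_ge(2)[OF d] by (simp add: power3_eq_cube power2_eq_square)
      then have "d div q < q ^ 2" by (simp add: less_mult_imp_div_less mult.commute)
      ultimately show "residue (b * d) \<in> T \<and> d div q \<in> {1..q ^ 2}" using d by (auto simp: T_def)
    qed
    fix d assume d: "d \<in> D"
    have k: "d div q > 0" using d_ge(1)[OF d] q_pos by (simp add: div_greater_zero_iff)
    have t: "residue (b * d) > 0" using d residue_pos[of "b * d"] by (auto simp: D_def)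
    have le: "real q * real (d div q) \<le> real d"
      by (metis of_nat_le_iff of_nat_mult times_div_less_eq_dividend)
    have "weight (b * d) / real b = real q / ((real b)\<^sup>2 * real (residue (b * d)) * real d)"
      by (simp add: weight_def power2_eq_square mult_ac)
    also have "\<dots> \<le> real q / ((real b)\<^sup>2 * real (residue (b * d)) * (real q * real (d div q)))"
      using le k t b0 q_pos by (intro frac_le mult_left_mono mult_pos_pos) auto
    also have "\<dots> = 1 / (real b)\<^sup>2 * ((1 / real (residue (b * d))) * (1 / real (d div q)))"
      using q_pos by simp
    finally show "weight (b * d) / real b \<le> (case (residue (b * d), d div q) of (t, k) \<Rightarrow>
        1 / (real b)\<^sup>2 * ((1 / real t) * (1 / real k)))" by simp
  qed (auto simp: finT)
  also have "\<dots> = 1 / (real b)\<^sup>2 * ((\<Sum>t\<in>T. 1 / real t) * harm (q ^ 2))"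
    unfolding harm_eq_sum sum_product sum.cartesian_product by (simp only: sum_distrib_left case_prod_beta')
  also have "\<dots> \<le> 1 / (real b)\<^sup>2 * ((1 / real K + 3 * lam / real b) * (67 * lam))"
    using sumT harm_q[of 2] K_large by (intro mult_left_mono mult_mono) (auto simp: harm_nonneg sum_nonneg)
  finally show ?thesis by (simp add: mult.assoc)
qed

text \<open>The threshold is the point up to which \<open>residue_proportional\<close>
  applies.\<close>

definition near_pairs :: "(nat \<times> nat) set"
  where "near_pairs = {(n, m) \<in> good \<times> good. n \<le> m \<and> 2 * (m div gcd n m) * K ^ 2 \<le> q}"

definition far_pairs :: "(nat \<times> nat) set"
  where "far_pairs = {(n, m) \<in> good \<times> good. n \<le> m \<and> q < 2 * (m div gcd n m) * K ^ 2}"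

lemma gcd_times_div:
  fixes n m :: nat
  assumes "n > 0" "m > 0"
  shows "(n div gcd n m) * gcd n m = n" "(m div gcd n m) * gcd n m = m"
    "n div gcd n m > 0" "m div gcd n m > 0" "gcd n m > 0"
  using assms by (auto simp: div_greater_zero_iff dvd_imp_le gcd_le1_nat gcd_le2_nat)

lemma pair_term:
  fixes n m :: nat
  assumes "n > 0" "m > 0"
  shows "real (gcd n m) / real m * weight m = weight ((m div gcd n m) * gcd n m) / real (m div gcd n m)"
proof -
  have "real m = real (m div gcd n m) * real (gcd n m)"
    using gcd_times_div(2)[OF assms] by (metis of_nat_mult)
  then have "real (gcd n m) / real m = 1 / real (m div gcd n m)"
    using gcd_times_div(4,5)[OF assms] by simp
  then show ?thesis using gcd_times_div(2)[OF assms] by simp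
qed

text \<open>There are at most b values of a for each b, which leaves 67 * lam times the sum of 1 /
  (K * b) + 3 * lam / b^2. The first part is at most 34 * lam because 1 / K \<le> 1, the second
  converges; 67 * (34 + 6) = 2680.\<close>

lemma sum_near_pairs: "(\<Sum>(n, m)\<in>near_pairs. real (gcd n m) / real m * weight m) \<le> 2680 * lam\<^sup>2"
proof -
  define I where "I = {(a, b). b \<in> {1..q} \<and> a \<in> {1..b} \<and> coprime a b \<and> 2 * b * K ^ 2 \<le> q}"
  define D where "D = (\<lambda>(a, b). {d. a * d \<in> good \<and> b * d \<in> good})"
  have finI: "finite I"
    by (rule finite_subset[of _ "{1..q} \<times> {1..q}"]) (auto simp: I_def)
  have finD: "finite (D i)" if "i \<in> I" for i
  proof -
    obtain a b where i: "i = (a, b)" by (cases i)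
    have "D i \<subseteq> {d. b * d \<in> good}" by (auto simp: D_def i)
    also have "\<dots> \<subseteq> {..<q ^ 3}"
    proof
      fix d assume "d \<in> {d. b * d \<in> good}"
      then have "b * d < q ^ 3" by (auto simp: good_def)
      moreover have "1 * d \<le> b * d" using that by (intro mult_le_mono1) (auto simp: I_def i)
      ultimately show "d \<in> {..<q ^ 3}" unfolding lessThan_iff by linarith
    qed
    finally show ?thesis by (rule finite_subset) simp
  qed
  have "(\<Sum>(n, m)\<in>near_pairs. real (gcd n m) / real m * weight m)
      \<le> (\<Sum>(i, d)\<in>Sigma I D. weight (snd i * d) / real (snd i))"
  proof (rule sum_le_inj[where h = "\<lambda>(n, m). ((n div gcd n m, m div gcd n m), gcd n m)"])
    show "finite (Sigma I D)" using finI finD by (rule finite_SigmaI)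
    show "inj_on (\<lambda>(n, m). ((n div gcd n m, m div gcd n m), gcd n m)) near_pairs"
      by (rule inj_onI) (auto simp: near_pairs_def, (metis dvd_div_mult_self gcd_dvd1 gcd_dvd2)+)
    show "(\<lambda>(n, m). ((n div gcd n m, m div gcd n m), gcd n m)) ` near_pairs \<subseteq> Sigma I D"
    proof clarify
      fix n m assume nm: "(n, m) \<in> near_pairs"
      then have good: "n \<in> good" "m \<in> good" "n \<le> m" and le: "2 * (m div gcd n m) * K ^ 2 \<le> q"
        by (auto simp: near_pairs_def)
      note pos = good_pos[OF good(1)] good_pos[OF good(2)]
      note g = gcd_times_div[OF pos]
      have "m div gcd n m \<le> 2 * (m div gcd n m) * K ^ 2" using K_ge by (cases K) (auto simp: power2_eq_square)
      then have "m div gcd n m \<le> q" using le by (rule order_trans)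
      moreover have "n div gcd n m \<le> m div gcd n m" using good(3) by (rule div_le_mono)
      moreover have "coprime (n div gcd n m) (m div gcd n m)"
        using pos by (intro div_gcd_coprime) auto
      ultimately have "(n div gcd n m, m div gcd n m) \<in> I"
        using g le by (auto simp: I_def)
      moreover have "gcd n m \<in> D (n div gcd n m, m div gcd n m)"
        using g good by (simp add: D_def)
      ultimately show "(n div gcd n m, m div gcd n m) \<in> I \<and> gcd n m \<in> D (n div gcd n m, m div gcd n m)" ..
    qed
    fix x assume x: "x \<in> near_pairs"
    show "(case x of (n, m) \<Rightarrow> real (gcd n m) / real m * weight m)
        \<le> (case case x of (n, m) \<Rightarrow> ((n div gcd n m, m div gcd n m), gcd n m) of (i, d) \<Rightarrow> weight (snd i * d) / real (snd i))"
      using x pair_term[of "fst x" "snd x"] good_pos by (auto simp: near_pairs_def)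
  qed (auto simp: weight_nonneg)
  also have "\<dots> = (\<Sum>i\<in>I. \<Sum>d\<in>D i. weight (snd i * d) / real (snd i))"
    using finI finD by (subst sum.Sigma) auto
  also have "\<dots> \<le> (\<Sum>i\<in>I. 1 / (real (snd i))\<^sup>2 * (1 / real K + 3 * lam / real (snd i)) * (67 * lam))"
  proof (rule sum_mono)
    fix i assume "i \<in> I"
    then obtain a b where "i = (a, b)" "0 < a" "a \<le> b" "2 * b * K ^ 2 \<le> q" "coprime a b"
      by (auto simp: I_def)
    then show "(\<Sum>d\<in>D i. weight (snd i * d) / real (snd i))
        \<le> 1 / (real (snd i))\<^sup>2 * (1 / real K + 3 * lam / real (snd i)) * (67 * lam)"
      using sum_weight_fixed_ratio[of a b] by (simp add: D_def)
  qed
  also have "\<dots> \<le> (\<Sum>(b, a)\<in>(SIGMA b:{1..q}. {1..b}). 1 / (real b)\<^sup>2 * (1 / real K + 3 * lam / real b) * (67 * lam))"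
    using K_large
    by (intro sum_le_inj[where h = prod.swap]) (auto simp: I_def intro!: mult_nonneg_nonneg add_nonneg_nonneg)
  also have "\<dots> = (\<Sum>b\<in>{1..q}. \<Sum>a\<in>{1..b}. 1 / (real b)\<^sup>2 * (1 / real K + 3 * lam / real b) * (67 * lam))"
    by (subst sum.Sigma) auto
  also have "\<dots> = (\<Sum>b\<in>{1..q}. 67 * lam * (1 / real K * (1 / real b) + 3 * lam * (1 / (real b)\<^sup>2)))"
    by (intro sum.cong refl) (simp add: power2_eq_square field_simps)
  also have "\<dots> = 67 * lam * (1 / real K * harm q + 3 * lam * (\<Sum>b\<in>{1..q}. 1 / (real b)\<^sup>2))"
    unfolding harm_eq_sum sum_distrib_left[symmetric] sum.distrib ..
  also have "\<dots> \<le> 67 * lam * (1 * (34 * lam) + 3 * lam * 2)"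
  proof -
    have "1 / real K \<le> 1" using K_ge by simp
    moreover have "harm q \<le> 34 * lam" using harm_q[of 1] by simp
    ultimately show ?thesis using K_large sum_inverse_squares_le[of q]
      by (intro mult_left_mono add_mono mult_mono) (auto simp: harm_nonneg)
  qed
  also have "\<dots> = 2680 * lam\<^sup>2" by (simp add: power2_eq_square)
  finally show ?thesis .
qed

section \<open>Pairs with large b: counting good multiples of d\<close>

lemma gcd_factor_le:
  assumes "x * d \<in> good"
  shows "gcd d q \<le> K ^ 14"
proof -
  have "gcd d q dvd gcd (x * d) q" by simp
  then have "gcd d q \<le> gcd (x * d) q" using q_pos by (intro dvd_imp_le) auto
  then show ?thesis using assms by (auto simp: good_def)
qed

text \<open>Both p modulo q and d div gcd d q modulo q div gcd d q are invertible and can be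
  cancelled. Hence the multipliers of d that produce a given residue lie in one progression with a
  large step.\<close>

lemma residue_class_of_multiples:
  assumes "residue (x * d) = residue (y * d)"
  shows "x mod (q div gcd d q) = y mod (q div gcd d q)"
proof -
  define g where "g = gcd d q"
  have "g > 0" using q_pos by (simp add: g_def)
  have q: "q = q div g * g" and d: "d = d div g * g" by (simp_all add: g_def)
  have cop: "coprime (d div g) (q div g)"
    unfolding g_def using q_pos by (intro div_gcd_coprime) auto
  have "int q dvd ((int x - int y) * int d) * p"
    using residue_diff_dvd[of "x * d" "y * d"] assms by (simp add: algebra_simps)
  then have "int q dvd (int x - int y) * int d" by (rule dvd_p_cancel)
  then have "int (q div g) * int g dvd ((int x - int y) * int (d div g)) * int g"
    by (metis q d of_nat_mult mult.assoc)
  then have "int (q div g) dvd (int x - int y) * int (d div g)"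
    using \<open>g > 0\<close> by simp
  then have "int (q div g) dvd int x - int y"
    using cop by (simp add: coprime_commute coprime_dvd_mult_left_iff)
  then show ?thesis unfolding g_def by (metis mod_eq_dvd_iff of_nat_eq_iff of_nat_mod)
qed

lemma modulus_bound:
  assumes "gcd d q \<le> K ^ 14"
  shows "q div gcd d q > 0" "1 / real (q div gcd d q) \<le> real K ^ 14 / real q"
proof -
  define Q where "Q = q div gcd d q"
  have q: "q = Q * gcd d q" by (simp add: Q_def)
  then have Q0: "Q > 0" using q_pos by (cases "Q = 0") auto
  have "real q \<le> real Q * real K ^ 14"
    using q assms by (metis mult_le_mono2 of_nat_le_iff of_nat_mult of_nat_power)
  then show "q div gcd d q > 0" "1 / real (q div gcd d q) \<le> real K ^ 14 / real q"
    using Q0 q_pos unfolding Q_def[symmetric] by (auto simp: divide_simps mult.commute)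
qed

lemma two_K_squared_le: "2 * real K ^ 2 \<le> real K ^ 14"
proof -
  have "2 * real K ^ 2 \<le> real K * real K ^ 2" using K_ge by (intro mult_right_mono) auto
  also have "\<dots> = real K ^ 3" by (simp add: power3_eq_cube power2_eq_square)
  also have "\<dots> \<le> real K ^ 14" using K_ge by (intro power_increasing) auto
  finally show ?thesis .
qed

text \<open>Each of the at most K^2 residues confines a to one progression of step Q \<ge> q / K^14,
  so to at most b / Q + 1 values. The assumption on b absorbs the summand 1 into K^14 * b /
  q.\<close>

lemma card_good_multiples_le:
  assumes b: "q < 2 * b * K ^ 2"
  shows "real (card {a. a * d \<in> good \<and> a \<le> b}) \<le> 2 * real K ^ 16 * real b / real q"
proof (cases "{a. a * d \<in> good \<and> a \<le> b} = {}")
  case True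
  show ?thesis unfolding True by simp
next
  case False
  define A where "A = {a. a * d \<in> good \<and> a \<le> b}"
  define Q where "Q = q div gcd d q"
  have "finite A" unfolding A_def by (rule finite_subset[of _ "{..b}"]) auto
  \<comment> \<open>A good multiple of d passes its gcd bound on to d, which is why the empty set is
    treated apart.\<close>
  have Q: "Q > 0" "1 / real Q \<le> real K ^ 14 / real q"
    using False gcd_factor_le modulus_bound[of d] unfolding Q_def by blast+
  have "card A = (\<Sum>t<K ^ 2. card {a \<in> A. residue (a * d) = t})"
    unfolding card_eq_sum using \<open>finite A\<close>
    by (intro sum.group[symmetric]) (auto simp: A_def good_def)
  also have "\<dots> \<le> (\<Sum>t<K ^ 2. b div Q + 1)"
    unfolding Q_def
    by (intro sum_mono card_congruent_le) (auto simp: A_def intro: residue_class_of_multiples)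
  finally have "card A \<le> K ^ 2 * (b div Q + 1)" by simp
  then have "real (card A) \<le> real (K ^ 2 * (b div Q + 1))" by (rule of_nat_mono)
  also have "\<dots> = real K ^ 2 * (real (b div Q) + 1)"
    unfolding of_nat_mult of_nat_power of_nat_add of_nat_1 ..
  also have "\<dots> \<le> real K ^ 2 * (real K ^ 14 * real b / real q + real K ^ 14 * real b / real q)"
  proof (intro mult_left_mono add_mono)
    have "real (b div Q) \<le> real b / real Q" by (rule of_nat_div_le_of_nat)
    also have "\<dots> = (1 / real Q) * real b" by simp
    also have "\<dots> \<le> real K ^ 14 / real q * real b" using Q(2) by (rule mult_right_mono) simp
    finally show "real (b div Q) \<le> real K ^ 14 * real b / real q" by simp
    have "real q \<le> real (2 * b * K ^ 2)" using b by (intro of_nat_mono) simp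
    also have "\<dots> = (2 * real K ^ 2) * real b" by simp
    also have "\<dots> \<le> real K ^ 14 * real b" using two_K_squared_le by (rule mult_right_mono) simp
    finally show "1 \<le> real K ^ 14 * real b / real q" using q_pos by (simp add: le_divide_eq)
  qed simp
  also have "\<dots> = 2 * (real K ^ 2 * real K ^ 14) * real b / real q" by simp
  also have "real K ^ 2 * real K ^ 14 = real K ^ 16" by (simp flip: power_add)
  finally show ?thesis unfolding A_def .
qed

text \<open>The same progressions, now summed with 1 / b. A term below Q could be large, but q < 2 *
  b * K^2 limits it to 2 * K^2 / q; the others give a harmonic sum over Q, with 100 = 3 * 33 + 1
  from \<open>harm_q\<close>.\<close>

lemma sum_inverse_good_multiples_le:
  assumes "d > 0"
  shows "(\<Sum>b\<in>{b. b * d \<in> good \<and> q < 2 * b * K ^ 2}. 1 / real b) \<le> 101 * lam * real K ^ 16 / real q"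
proof (cases "{b. b * d \<in> good \<and> q < 2 * b * K ^ 2} = {}")
  case True
  show ?thesis unfolding True using K_large by simp
next
  case False
  define B where "B = {b. b * d \<in> good \<and> q < 2 * b * K ^ 2}"
  define Q where "Q = q div gcd d q"
  have B_le: "b \<le> q ^ 3" if "b \<in> B" for b
  proof -
    have "b * 1 \<le> b * d" using assms by (intro mult_le_mono2) simp
    moreover have "b * d < q ^ 3" using that by (auto simp: B_def good_def)
    ultimately show ?thesis by linarith
  qed
  have "finite B" using B_le by (meson finite_nat_set_iff_bounded_le)
  have Q: "Q > 0" "1 / real Q \<le> real K ^ 14 / real q"
    using False gcd_factor_le modulus_bound[of d] unfolding Q_def by blast+
  have K0: "real K > 0" using K_ge by simp
  have "(\<Sum>b\<in>B. 1 / real b) = (\<Sum>t<K ^ 2. \<Sum>b\<in>{b \<in> B. residue (b * d) = t}. 1 / real b)"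
    using \<open>finite B\<close> by (intro sum.group[symmetric]) (auto simp: B_def good_def)
  also have "\<dots> \<le> (\<Sum>t<K ^ 2. 1 / (real q / (2 * real K ^ 2)) + harm (q ^ 3) / real Q)"
  proof (intro sum_mono sum_inverse_congruent_le)
    fix t
    show "x mod Q = y mod Q" if "x \<in> {b \<in> B. residue (b * d) = t}" "y \<in> {b \<in> B. residue (b * d) = t}" for x y
      using that unfolding Q_def by (intro residue_class_of_multiples) auto
    show "real q / (2 * real K ^ 2) \<le> real x" if "x \<in> {b \<in> B. residue (b * d) = t}" for x
    proof -
      have "real q \<le> real (2 * x * K ^ 2)" using that by (intro of_nat_mono) (auto simp: B_def)
      then show ?thesis using K0 by (simp add: divide_le_eq mult_ac)
    qed
    show "x \<le> q ^ 3" if "x \<in> {b \<in> B. residue (b * d) = t}" for x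
      using that B_le by auto
  qed (use Q q_pos K0 in auto)
  also have "\<dots> = real K ^ 2 * (2 * real K ^ 2 / real q + harm (q ^ 3) * (1 / real Q))" by simp
  also have "\<dots> \<le> real K ^ 2 * (lam * real K ^ 14 / real q + (100 * lam) * (real K ^ 14 / real q))"
  proof (intro mult_left_mono add_mono mult_mono)
    have "1 * (2 * real K ^ 2) \<le> lam * real K ^ 14"
      using two_K_squared_le K_large by (intro mult_mono) auto
    then show "2 * real K ^ 2 / real q \<le> lam * real K ^ 14 / real q"
      by (intro divide_right_mono) auto
    show "harm (q ^ 3) \<le> 100 * lam" using harm_q[of 3] by simp
  qed (use Q K_large in auto)
  also have "\<dots> = 101 * lam * (real K ^ 2 * real K ^ 14) / real q" by (simp add: field_simps)
  also have "real K ^ 2 * real K ^ 14 = real K ^ 16" by (simp flip: power_add)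
  finally show ?thesis unfolding B_def .
qed

text \<open>Here d is fixed first and the residue in the weight is only bounded below by 1. The sum
  over a gains K^16 * b / q, which cancels the q of the weight; the sum over b gains K^16 / q.
  Together K^32 / q \<le> 1, and the sums over b and d leave one logarithm each.\<close>

lemma sum_far_pairs: "(\<Sum>(n, m)\<in>far_pairs. real (gcd n m) / real m * weight m) \<le> 20200 * lam\<^sup>2"
proof -
  define B where "B d = {b. b * d \<in> good \<and> q < 2 * b * K ^ 2}" for d
  define A where "A d b = {a. a * d \<in> good \<and> a \<le> b}" for d b
  have finA: "finite (A d b)" for d b
    unfolding A_def by (rule finite_subset[of _ "{..b}"]) auto
  have finB: "finite (B d)" if "d \<in> {1..q ^ 3}" for d
  proof (rule finite_subset[of _ "{..<q ^ 3}"])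
    show "B d \<subseteq> {..<q ^ 3}"
    proof
      fix b assume "b \<in> B d"
      then have "b * d < q ^ 3" by (auto simp: B_def good_def)
      moreover have "b * 1 \<le> b * d" using that by (intro mult_le_mono2) simp
      ultimately show "b \<in> {..<q ^ 3}" unfolding lessThan_iff by linarith
    qed
  qed simp
  have K0: "real K > 0" using K_ge by simp
  define h where "h = (\<lambda>(n, m :: nat). (gcd n m, m div gcd n m, n div gcd n m))"
  have "(\<Sum>(n, m)\<in>far_pairs. real (gcd n m) / real m * weight m)
      \<le> (\<Sum>(d, b, a)\<in>(SIGMA d:{1..q ^ 3}. SIGMA b:B d. A d b). weight (b * d) / real b)"
  proof (rule sum_le_inj[where h = h])
    show "finite (SIGMA d:{1..q ^ 3}. SIGMA b:B d. A d b)"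
      using finA finB by (intro finite_SigmaI) auto
    show "inj_on h far_pairs"
      unfolding h_def by (rule inj_onI) (auto simp: far_pairs_def, (metis dvd_div_mult_self gcd_dvd1 gcd_dvd2)+)
    show "h ` far_pairs \<subseteq> (SIGMA d:{1..q ^ 3}. SIGMA b:B d. A d b)"
    proof
      fix y assume "y \<in> h ` far_pairs"
      then obtain n m where nm: "(n, m) \<in> far_pairs" and y: "y = (gcd n m, m div gcd n m, n div gcd n m)"
        by (auto simp: h_def)
      then have good: "n \<in> good" "m \<in> good" "n \<le> m" and lt: "q < 2 * (m div gcd n m) * K ^ 2"
        by (auto simp: far_pairs_def)
      note pos = good_pos[OF good(1)] good_pos[OF good(2)]
      note g = gcd_times_div[OF pos]
      have "gcd n m \<le> m" using pos by (intro gcd_le2_nat) simp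
      then have "gcd n m \<le> q ^ 3" using good(2) by (auto simp: good_def)
      moreover have "n div gcd n m \<le> m div gcd n m" using good(3) by (rule div_le_mono)
      moreover have "1 \<le> gcd n m" using g(5) by linarith
      ultimately show "y \<in> (SIGMA d:{1..q ^ 3}. SIGMA b:B d. A d b)"
        using g(1,2) lt good unfolding y A_def B_def by simp
    qed
    fix x assume x: "x \<in> far_pairs"
    show "(case x of (n, m) \<Rightarrow> real (gcd n m) / real m * weight m)
        \<le> (case h x of (d, b, a) \<Rightarrow> weight (b * d) / real b)"
      using x pair_term[of "fst x" "snd x"] good_pos by (auto simp: far_pairs_def h_def)
  qed (auto simp: weight_nonneg)
  also have "\<dots> = (\<Sum>d\<in>{1..q ^ 3}. \<Sum>b\<in>B d. \<Sum>a\<in>A d b. weight (b * d) / real b)"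
  proof -
    have "(\<Sum>d\<in>{1..q ^ 3}. \<Sum>b\<in>B d. \<Sum>a\<in>A d b. weight (b * d) / real b)
        = (\<Sum>d\<in>{1..q ^ 3}. \<Sum>(b, a)\<in>(SIGMA b:B d. A d b). weight (b * d) / real b)"
      using finA finB by (intro sum.cong refl sum.Sigma) auto
    also have "\<dots> = (\<Sum>(d, b, a)\<in>(SIGMA d:{1..q ^ 3}. SIGMA b:B d. A d b). weight (b * d) / real b)"
      using finA finB by (subst sum.Sigma) auto
    finally show ?thesis ..
  qed
  also have "\<dots> \<le> (\<Sum>d\<in>{1..q ^ 3}. \<Sum>b\<in>B d. 2 * real K ^ 16 * (1 / real d) * (1 / real b))"
  proof (intro sum_mono)
    fix d b assume d: "d \<in> {1..q ^ 3}" and b: "b \<in> B d"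
    have b0: "b > 0" using b by (auto simp: B_def intro: Nat.gr0I)
    have "residue (b * d) \<ge> 1" using b residue_pos[of "b * d"] by (simp add: B_def)
    then have "weight (b * d) \<le> real q / (real (b * d) * 1)"
      unfolding weight_def using b0 d by (intro frac_le mult_left_mono) auto
    then have w: "weight (b * d) / real b \<le> real q / (real b * real d) / real b"
      by (intro divide_right_mono) auto
    have "(\<Sum>a\<in>A d b. weight (b * d) / real b) = real (card (A d b)) * (weight (b * d) / real b)"
      by simp
    also have "\<dots> \<le> (2 * real K ^ 16 * real b / real q) * (real q / (real b * real d) / real b)"
      using card_good_multiples_le[of b d] w b unfolding A_def B_def
      by (intro mult_mono) (auto simp: weight_nonneg)
    also have "\<dots> = 2 * real K ^ 16 * (1 / real d) * (1 / real b)"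
      using b0 q_pos by simp
    finally show "(\<Sum>a\<in>A d b. weight (b * d) / real b) \<le> 2 * real K ^ 16 * (1 / real d) * (1 / real b)" .
  qed
  also have "\<dots> = (\<Sum>d\<in>{1..q ^ 3}. 2 * real K ^ 16 * (1 / real d) * (\<Sum>b\<in>B d. 1 / real b))"
    by (simp only: sum_distrib_left)
  also have "\<dots> \<le> (\<Sum>d\<in>{1..q ^ 3}. 2 * real K ^ 16 * (1 / real d) * (101 * lam * real K ^ 16 / real q))"
    unfolding B_def by (intro sum_mono mult_left_mono sum_inverse_good_multiples_le) auto
  also have "\<dots> = harm (q ^ 3) * (202 * lam) * ((real K ^ 16 * real K ^ 16) / real q)"
    unfolding harm_eq_sum sum_distrib_right by (intro sum.cong refl) simp
  also have "\<dots> \<le> (100 * lam) * (202 * lam) * 1"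
  proof (intro mult_mono)
    show "harm (q ^ 3) \<le> 100 * lam" using harm_q[of 3] by simp
    have "real K ^ 16 * real K ^ 16 = real (K ^ 32)" by (simp flip: power_add)
    also have "\<dots> \<le> real q" using K_le by (rule of_nat_mono)
    finally show "real K ^ 16 * real K ^ 16 / real q \<le> 1" using q_pos by simp
  qed (use K_large in \<open>auto simp: harm_nonneg\<close>)
  also have "\<dots> = 20200 * lam\<^sup>2" by (simp add: power2_eq_square)
  finally show ?thesis .
qed

lemma sum_gcd_weight_le:
  "(\<Sum>m\<in>good. \<Sum>n\<in>{n \<in> good. n \<le> m}. real (gcd n m) * (weight m / real m)) \<le> 22880 * lam\<^sup>2"
proof -
  have fin: "finite near_pairs" "finite far_pairs"
    by (rule finite_subset[of _ "good \<times> good"]; force simp: near_pairs_def far_pairs_def finite_good)+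
  have disj: "near_pairs \<inter> far_pairs = {}"
    unfolding near_pairs_def far_pairs_def by auto
  have un: "near_pairs \<union> far_pairs = {(n, m). n \<in> good \<and> m \<in> good \<and> n \<le> m}"
    unfolding near_pairs_def far_pairs_def by auto
  have "(\<Sum>m\<in>good. \<Sum>n\<in>{n \<in> good. n \<le> m}. real (gcd n m) * (weight m / real m))
      = (\<Sum>(m, n)\<in>(SIGMA m:good. {n \<in> good. n \<le> m}). real (gcd n m) / real m * weight m)"
    using finite_good by (subst sum.Sigma) (auto simp: mult.commute)
  also have "\<dots> = (\<Sum>(n, m)\<in>near_pairs \<union> far_pairs. real (gcd n m) / real m * weight m)"
    unfolding un by (rule sum.reindex_bij_witness[of _ prod.swap prod.swap]) auto
  also have "\<dots> = (\<Sum>(n, m)\<in>near_pairs. real (gcd n m) / real m * weight m)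
      + (\<Sum>(n, m)\<in>far_pairs. real (gcd n m) / real m * weight m)"
    using fin disj by (rule sum.union_disjoint)
  also have "\<dots> \<le> 2680 * lam\<^sup>2 + 20200 * lam\<^sup>2"
    by (intro add_mono sum_near_pairs sum_far_pairs)
  finally show ?thesis by simp
qed

text \<open>The weights are the diagonal terms n = m of the gcd sum.\<close>

lemma sum_weight_le: "(\<Sum>n\<in>good. weight n) \<le> 22880 * lam\<^sup>2"
proof -
  have "(\<Sum>m\<in>good. weight m) \<le> (\<Sum>m\<in>good. \<Sum>n\<in>{n \<in> good. n \<le> m}. real (gcd n m) * (weight m / real m))"
  proof (rule sum_mono)
    fix m assume m: "m \<in> good"
    have "weight m = (\<Sum>n\<in>{m}. real (gcd n m) * (weight m / real m))"
      using good_pos[OF m] by simp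
    also have "\<dots> \<le> (\<Sum>n\<in>{n \<in> good. n \<le> m}. real (gcd n m) * (weight m / real m))"
      using m finite_good by (intro sum_mono2) (auto simp: weight_nonneg)
    finally show "weight m \<le> (\<Sum>n\<in>{n \<in> good. n \<le> m}. real (gcd n m) * (weight m / real m))" .
  qed
  then show ?thesis using sum_gcd_weight_le by linarith
qed

end

section \<open>Liouville numbers\<close>

lemma dist_int_le: "dist_int x \<le> \<bar>x - of_int z\<bar>"
  unfolding dist_int_def using infdist_le[of "of_int z" \<int> x] by (simp add: dist_real_def)

lemma dist_int_nonneg: "dist_int x \<ge> 0"
  by (simp add: dist_int_def infdist_nonneg)

lemma dist_int_add_int: "dist_int (x + of_int k) = dist_int x"
proof (rule antisym)
  show "dist_int (x + of_int k) \<le> dist_int x"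
    using dist_int_le[of "x + of_int k" "round x + k"] by (simp add: dist_int_eq_round[of x])
  show "dist_int x \<le> dist_int (x + of_int k)"
    using dist_int_le[of x "round (x + of_int k) - k"]
    by (simp add: dist_int_eq_round[of "x + of_int k"] algebra_simps)
qed

text \<open>Reducing a fraction only improves |q * \<alpha> - p| and shrinks the denominator, so the
  quality survives. The reduced denominator must still be large: irrationality keeps
  \<open>dist_int\<close> of j * \<alpha> away from 0 for all 1 \<le> j \<le> M, while 1 / n is
  below that gap.\<close>

lemma liouville_reduced_fraction:
  assumes "liouville_number \<alpha>"
  obtains p :: int and q :: nat where "q \<ge> M" "q \<ge> 1" "coprime p (int q)" "\<bar>real q * \<alpha> - of_int p\<bar> \<le> 1 / real q ^ 3"
proof -
  have irr: "\<alpha> \<notin> \<rat>" and inf: "infinite {n::nat. n \<ge> 1 \<and> dist_int (real n * \<alpha>) < real n powr (- 3)}"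
    using assms unfolding liouville_number_def by (auto dest: spec[of _ 3])
  have pos: "dist_int (real j * \<alpha>) > 0" if "j \<ge> 1" for j
  proof (rule ccontr)
    assume "\<not> dist_int (real j * \<alpha>) > 0"
    then have "real j * \<alpha> = of_int (round (real j * \<alpha>))"
      using dist_int_eq_round[of "real j * \<alpha>"] by simp
    then have "\<alpha> = of_int (round (real j * \<alpha>)) / of_nat j" using that by (simp add: field_simps)
    also have "\<dots> \<in> \<rat>" by (intro Rats_divide Rats_of_int Rats_of_nat)
    finally show False using irr by simp
  qed
  \<comment> \<open>The inserted 1 keeps the set nonempty when M = 0.\<close>
  define \<delta> where "\<delta> = Min (insert 1 ((\<lambda>j. dist_int (real j * \<alpha>)) ` {1..M}))"
  have "\<delta> > 0" using pos by (simp add: \<delta>_def)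
  have \<delta>: "\<delta> \<le> dist_int (real j * \<alpha>)" if "1 \<le> j" "j \<le> M" for j
    unfolding \<delta>_def using that by (intro Min_le) auto
  obtain m :: nat where m: "1 / \<delta> < real m" using reals_Archimedean2 by blast
  obtain n where n: "n > m" "n \<ge> 1" "dist_int (real n * \<alpha>) < real n powr (- 3)"
    using inf unfolding infinite_nat_iff_unbounded by blast
  define p where "p = round (real n * \<alpha>)"
  define g where "g = nat (gcd p (int n))"
  have g: "int g = gcd p (int n)" by (simp add: g_def)
  have "g > 0" using n(2) by (simp add: g_def)
  obtain p' q' where pq: "p = p' * gcd p (int n)" "int n = q' * gcd p (int n)" "coprime p' q'"
    using gcd_coprime_exists[of p "int n"] n(2) by auto
  have "q' > 0" using pq(2) n(2) by (metis gcd_ge_0_int less_le_trans mult_nonpos_nonneg not_less of_nat_0_less_iff zero_less_one)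
  define q where "q = nat q'"
  have q: "int q = q'" "q \<ge> 1" using \<open>q' > 0\<close> by (auto simp: q_def)
  have nq: "real n = real q * real g"
    using pq(2) q(1) g by (metis of_nat_mult of_nat_eq_iff)
  have "real q \<le> real n" using nq \<open>g > 0\<close> mult_left_mono[of 1 "real g" "real q"] by simp
  have "\<bar>real n * \<alpha> - of_int p\<bar> < 1 / real n ^ 3"
    using n(2,3) unfolding dist_int_eq_round p_def by (simp add: powr_minus powr_realpow inverse_eq_divide)
  moreover have "real n * \<alpha> - of_int p = real g * (real q * \<alpha> - of_int p')"
    using pq(1) nq g by (metis (no_types, opaque_lifting) mult.commute mult.assoc of_int_mult of_int_of_nat_eq right_diff_distrib)
  ultimately have "real g * \<bar>real q * \<alpha> - of_int p'\<bar> < 1 / real n ^ 3"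
    by (simp add: abs_mult)
  moreover have "\<bar>real q * \<alpha> - of_int p'\<bar> \<le> real g * \<bar>real q * \<alpha> - of_int p'\<bar>"
    using \<open>g > 0\<close> mult_right_mono[of 1 "real g" "\<bar>real q * \<alpha> - of_int p'\<bar>"] by simp
  ultimately have less: "\<bar>real q * \<alpha> - of_int p'\<bar> < 1 / real n ^ 3" by linarith
  have "\<not> q < M"
  proof
    assume "q < M"
    then have "\<delta> \<le> dist_int (real q * \<alpha>)" using q(2) by (intro \<delta>) auto
    also have "\<dots> \<le> \<bar>real q * \<alpha> - of_int p'\<bar>" by (rule dist_int_le)
    also have "\<dots> < 1 / real n ^ 3" by (rule less)
    also have "\<dots> \<le> 1 / real n"
    proof -
      have "real n ^ 1 \<le> real n ^ 3" using n(2) by (intro power_increasing) auto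
      then show ?thesis using n(2) by (intro divide_left_mono) auto
    qed
    also have "\<dots> < \<delta>"
    proof -
      have "1 / \<delta> < real n" using m n(1) by linarith
      then show ?thesis using \<open>\<delta> > 0\<close> n(2) by (simp add: field_simps)
    qed
    finally show False .
  qed
  moreover have "1 / real n ^ 3 \<le> 1 / real q ^ 3"
    using \<open>real q \<le> real n\<close> q(2) by (intro divide_left_mono power_mono) auto
  ultimately show ?thesis
    using that[of q p'] q pq(3) less by auto
qed

text \<open>K is the largest integer with K^32 \<le> q. Then q \<le> (K + 1)^32 \<le> 2^32 * K^32,
  and K \<ge> 2^32 turns the constant into one more factor K.\<close>

lemma close_fraction_parameter:
  fixes q :: nat
  assumes "(2 ^ 32) ^ 32 \<le> q"
  obtains K :: nat where "ln (real K) \<ge> 4" "K ^ 32 \<le> q" "q \<le> K ^ 33"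
proof -
  define A where "A = {k. k ^ 32 \<le> q}"
  have le: "k \<le> q" if "k ^ 32 \<le> q" for k
    using that self_le_power[of k 32] by (cases "k = 0") auto
  have "A \<subseteq> {..q}" unfolding A_def using le by blast
  then have fin: "finite A" by (rule finite_subset) simp
  define K where "K = Max A"
  have big: "2 ^ 32 \<in> A" using assms by (simp only: A_def mem_Collect_eq)
  then have "K \<in> A" unfolding K_def using fin by (intro Max_in) auto
  have K32: "2 ^ 32 \<le> K" unfolding K_def using fin big by (rule Max_ge)
  have "Suc K \<notin> A" unfolding K_def using fin Max_ge not_less_eq_eq by blast
  then have "q \<le> (Suc K) ^ 32" by (simp add: A_def del: power_Suc)
  also have "\<dots> \<le> (2 * K) ^ 32" using K32 by (intro power_mono) auto
  also have "\<dots> = 2 ^ 32 * K ^ 32" by (rule power_mult_distrib)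
  also have "\<dots> \<le> K * K ^ 32" using K32 by (rule mult_le_mono1)
  also have "\<dots> = K ^ 33" by (simp flip: power_Suc)
  finally have 1: "q \<le> K ^ 33" .
  have "exp (4::real) = exp 1 ^ 4" by (simp flip: exp_of_nat_mult)
  also have "\<dots> \<le> 3 ^ 4" using exp_le by (intro power_mono) auto
  also have "\<dots> \<le> real (2 ^ 32)" by simp
  also have "\<dots> \<le> real K" using K32 by (rule of_nat_mono)
  finally have "4 \<le> ln (real K)" by (subst ln_ge_iff) (use K32 in auto)
  then show ?thesis using that 1 \<open>K \<in> A\<close> by (simp add: A_def)
qed

section \<open>The exceptional set of the second coordinate\<close>

context
  fixes \<alpha> \<gamma>\<^sub>1 \<gamma>\<^sub>2 :: real
begin

definition littlewood_product :: "nat \<Rightarrow> real \<Rightarrow> real"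
  where "littlewood_product n x = real n * (ln (real n))\<^sup>2 * dist_int (real n * \<alpha> - \<gamma>\<^sub>1) * dist_int (real n * x - \<gamma>\<^sub>2)"

text \<open>After multiplication by q, replacing \<alpha> by p / q costs at most 1 because n < q^3,
  and replacing q * \<open>\<gamma>\<^sub>1\<close> by its floor costs at most 1. Since the residue
  is at least 1, residue + 2 \<le> 3 * residue.\<close>

lemma dist_int_good_le:
  assumes "close_fraction p q K" and c: "c = \<lfloor>real q * \<gamma>\<^sub>1\<rfloor>"
    and close: "\<bar>real q * \<alpha> - of_int p\<bar> \<le> 1 / real q ^ 3"
    and n: "n \<in> close_fraction.good p c q K"
  shows "dist_int (real n * \<alpha> - \<gamma>\<^sub>1) \<le> 3 * real (close_fraction.residue p c q n) / real q"
proof -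
  interpret close_fraction p c q K by fact
  have q0: "real q > 0" using q_pos by simp
  obtain z where z: "int n * p - c - int (residue n) = int q * z"
    using residue_dvd[of n] by (auto simp: dvd_def)
  then have "real_of_int (int n * p - c - int (residue n)) = real_of_int (int q * z)" by simp
  then have z': "real n * of_int p - of_int c - real (residue n) = real q * of_int z" by simp
  have "real n < real (q ^ 3)" using n by (intro of_nat_less_iff[THEN iffD2]) (simp add: good_def)
  then have "real n * \<bar>real q * \<alpha> - of_int p\<bar> \<le> real q ^ 3 * (1 / real q ^ 3)"
    using close by (intro mult_mono) auto
  then have 1: "\<bar>real n * (real q * \<alpha> - of_int p)\<bar> \<le> 1" using q0 by (simp add: abs_mult)
  have 2: "\<bar>of_int c - real q * \<gamma>\<^sub>1\<bar> \<le> 1" unfolding c by linarith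
  have 3: "1 \<le> real (residue n)" using residue_pos[OF n] by simp
  have "real q * (real n * \<alpha> - \<gamma>\<^sub>1 - of_int z)
      = real n * (real q * \<alpha> - of_int p) + (of_int c - real q * \<gamma>\<^sub>1) + real (residue n)"
    using z' by (simp add: algebra_simps)
  then have "\<bar>real q * (real n * \<alpha> - \<gamma>\<^sub>1 - of_int z)\<bar> \<le> 3 * real (residue n)"
    using 1 2 3 by linarith
  then have "\<bar>real n * \<alpha> - \<gamma>\<^sub>1 - of_int z\<bar> \<le> 3 * real (residue n) / real q"
    using q0 by (simp add: abs_mult le_divide_eq mult.commute)
  then show ?thesis using dist_int_le[of "real n * \<alpha> - \<gamma>\<^sub>1" z] by linarith
qed

text \<open>For each N a fresh p / q, with q large in terms of N, supplies the function that
  \<open>null_set_by_uniform_mass\<close> asks for, with constants depending only on e.\<close>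

lemma littlewood_product_large_null:
  assumes liouville: "liouville_number \<alpha>" and "e > 0"
  shows "{x \<in> {0..<1}. \<forall>n\<ge>N\<^sub>0. e \<le> littlewood_product n x} \<in> null_sets lebesgue"
proof -
  define V where "V = {x \<in> {0..<1}. \<forall>n\<ge>N\<^sub>0. e \<le> littlewood_product n x}"
  \<comment> \<open>On a ball the product is at most 3 * 99^2 * \<epsilon> = 29403 * \<epsilon>; the
    cap 1 keeps n * \<rho> n below 1 / 2.\<close>
  define \<epsilon> where "\<epsilon> = min 1 (e / 30000)"
  have \<epsilon>: "\<epsilon> > 0" "\<epsilon> \<le> 1" "29403 * \<epsilon> < e" using assms by (auto simp: \<epsilon>_def min_def)
  define C where "C = 8 * (22880 * \<epsilon>)\<^sup>2 + 4 * (22880 * \<epsilon>)"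
  have "V \<in> null_sets lebesgue"
  proof (rule null_set_by_uniform_mass[of V \<epsilon> C])
    have "closed {x. e \<le> littlewood_product n x}" for n
      unfolding littlewood_product_def dist_int_def by (intro closed_Collect_le continuous_intros) 
    then have "closed (\<Inter>n\<in>{N\<^sub>0..}. {x. e \<le> littlewood_product n x})" by (intro closed_INT) auto
    moreover have "V = {0..<1} \<inter> (\<Inter>n\<in>{N\<^sub>0..}. {x. e \<le> littlewood_product n x})" by (auto simp: V_def)
    ultimately have "V \<in> sets borel" by (auto intro!: sets.Int borel_closed)
    then show "V \<in> sets lebesgue" by simp
    show "V \<subseteq> {0..<1}" by (auto simp: V_def)
    show "0 < \<epsilon>" by fact
    show "0 < C" using \<epsilon> by (simp add: C_def add_nonneg_pos)
    fix N :: nat assume N: "N \<ge> 1"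
    \<comment> \<open>The first summand provides K, the second puts all good n beyond
      \<open>N\<^sub>0\<close>, and the third gives n / N \<ge> 4, so that cells are long compared
      with the spacing 1 / n.\<close>
    obtain p q where q: "q \<ge> (2 ^ 32) ^ 32 + N\<^sub>0 + 4 * N" "q \<ge> 1" "coprime p (int q)"
        and close: "\<bar>real q * \<alpha> - of_int p\<bar> \<le> 1 / real q ^ 3"
      using liouville_reduced_fraction[OF liouville] by blast
    obtain K where K: "ln (real K) \<ge> 4" "K ^ 32 \<le> q" "q \<le> K ^ 33"
      using close_fraction_parameter[of q] q(1) by (metis add_leD1)
    define c where "c = \<lfloor>real q * \<gamma>\<^sub>1\<rfloor>"
    interpret close_fraction p c q K using q K by unfold_locales
    \<comment> \<open>Dividing by lam^2 removes the dependence on q: the sum of n * \<rho> n lies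
      between \<epsilon> and 22880 * \<epsilon>, and the gcd sum is at most 22880 * \<epsilon>.
      These two upper bounds make up C.\<close>
    define \<rho> where "\<rho> n = \<epsilon> / lam\<^sup>2 * (weight n / real n)" for n
    define g where "g = frac \<gamma>\<^sub>2"
    have g: "0 \<le> g" "g < 1" by (auto simp: g_def frac_lt_1)
    have lam: "lam\<^sup>2 \<ge> 16" using K_large power_mono[of 4 lam 2] by simp
    have \<rho>_nonneg: "\<rho> n \<ge> 0" for n using \<epsilon> by (simp add: \<rho>_def weight_nonneg)
    have n\<rho>: "real n * \<rho> n = \<epsilon> / lam\<^sup>2 * weight n" if "n \<in> good" for n
      using good_pos[OF that] by (simp add: \<rho>_def)
    have M: "(\<Sum>n\<in>good. real n * \<rho> n) = \<epsilon> / lam\<^sup>2 * (\<Sum>n\<in>good. weight n)"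
      unfolding sum_distrib_left by (intro sum.cong refl n\<rho>)
    have M1: "\<epsilon> \<le> (\<Sum>n\<in>good. real n * \<rho> n)"
    proof -
      have "\<epsilon> / lam\<^sup>2 * lam\<^sup>2 \<le> \<epsilon> / lam\<^sup>2 * (\<Sum>n\<in>good. weight n)"
        using sum_weight_ge \<epsilon> by (intro mult_left_mono) auto
      then show ?thesis unfolding M using K_large by (simp add: mult.commute)
    qed
    have M2: "(\<Sum>n\<in>good. real n * \<rho> n) \<le> 22880 * \<epsilon>"
    proof -
      have "\<epsilon> / lam\<^sup>2 * (\<Sum>n\<in>good. weight n) \<le> \<epsilon> / lam\<^sup>2 * (22880 * lam\<^sup>2)"
        using sum_weight_le \<epsilon> by (intro mult_left_mono) auto
      then show ?thesis unfolding M using K_large by (simp add: mult.commute)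
    qed
    have H: "(\<Sum>m\<in>good. \<Sum>n\<in>{n \<in> good. n \<le> m}. real (gcd n m) * \<rho> m) \<le> 22880 * \<epsilon>"
    proof -
      have "(\<Sum>m\<in>good. \<Sum>n\<in>{n \<in> good. n \<le> m}. real (gcd n m) * \<rho> m)
          = \<epsilon> / lam\<^sup>2 * (\<Sum>m\<in>good. \<Sum>n\<in>{n \<in> good. n \<le> m}. real (gcd n m) * (weight m / real m))"
        unfolding sum_distrib_left \<rho>_def by (intro sum.cong refl) simp
      also have "\<dots> \<le> \<epsilon> / lam\<^sup>2 * (22880 * lam\<^sup>2)"
        using sum_gcd_weight_le \<epsilon> by (intro mult_left_mono) auto
      finally show ?thesis using K_large by (simp add: mult.commute)
    qed
    have n_ge: "q \<le> n" if "n \<in> good" for n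
    proof -
      have "q \<le> q ^ 2" using q_pos by (simp add: power2_eq_square)
      then show ?thesis using that by (auto simp: good_def)
    qed
    have small: "real n * \<rho> n \<le> 1 / 2" if "n \<in> good" for n
    proof -
      have "weight n \<le> real q / (real q * 1)"
        unfolding weight_def using q_pos n_ge[OF that] residue_pos[OF that]
        by (intro frac_le mult_mono) auto
      then have "weight n \<le> 1" using q_pos by simp
      moreover have "\<epsilon> / lam\<^sup>2 \<le> 1 / 16" using \<epsilon> lam by (intro frac_le) auto
      ultimately have "\<epsilon> / lam\<^sup>2 * weight n \<le> 1 / 16 * 1"
        using \<epsilon> by (intro mult_mono) (auto simp: weight_nonneg)
      then show ?thesis using n\<rho>[OF that] by simp
    qed
    define f where "f = fraction_balls good \<rho> g"
    note ball_conds = finite_good good_pos \<rho>_nonneg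
    \<comment> \<open>A ball containing x would yield a good n \<ge> \<open>N\<^sub>0\<close> with
      product below e, against the definition of V.\<close>
    have "f x = 0" if x: "x \<in> V" for x
    proof -
      have "x \<notin> cball ((real k + g) / real n) (\<rho> n)" if n: "n \<in> good" for n k
      proof
        assume "x \<in> cball ((real k + g) / real n) (\<rho> n)"
        then have b: "\<bar>x - (real k + g) / real n\<bar> \<le> \<rho> n" by (simp add: dist_real_def abs_minus_commute)
        have n0: "real n > 0" using good_pos[OF n] by simp
        have t0: "real (residue n) > 0" using residue_pos[OF n] by simp
        have q0: "real q > 0" using q_pos by simp
        have "real n * x - \<gamma>\<^sub>2 - of_int (int k - \<lfloor>\<gamma>\<^sub>2\<rfloor>) = real n * (x - (real k + g) / real n)"
          using n0 by (simp add: g_def frac_def field_simps)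
        then have "\<bar>real n * x - \<gamma>\<^sub>2 - of_int (int k - \<lfloor>\<gamma>\<^sub>2\<rfloor>)\<bar> \<le> real n * \<rho> n"
          using b n0 by (simp only: abs_mult abs_of_nat mult_left_mono)
        then have d2: "dist_int (real n * x - \<gamma>\<^sub>2) \<le> \<epsilon> / lam\<^sup>2 * weight n"
          using dist_int_le[of "real n * x - \<gamma>\<^sub>2" "int k - \<lfloor>\<gamma>\<^sub>2\<rfloor>"] n\<rho>[OF n] by linarith
        have d1: "dist_int (real n * \<alpha> - \<gamma>\<^sub>1) \<le> 3 * real (residue n) / real q"
          using close_fraction_axioms c_def close n by (rule dist_int_good_le)
        \<comment> \<open>This yields ln n \<le> 3 * 33 * lam, the source of 99.\<close>
        have "n \<le> q ^ 3" using n by (simp add: good_def)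
        then have "ln (real n) \<le> ln (real (q ^ 3))" using n0 q0 by (subst ln_le_cancel_iff) (auto simp flip: of_nat_power)
        also have "\<dots> \<le> 99 * lam" using ln_q(2) q0 by (simp add: ln_realpow)
        finally have l: "(ln (real n))\<^sup>2 \<le> (99 * lam)\<^sup>2" using n0 by (intro power_mono) auto
        have "littlewood_product n x \<le> real n * (99 * lam)\<^sup>2 * (3 * real (residue n) / real q) * (\<epsilon> / lam\<^sup>2 * weight n)"
          unfolding littlewood_product_def using d1 d2 l by (intro mult_mono) (auto simp: dist_int_nonneg)
        also have "\<dots> = 29403 * \<epsilon>"
          using n0 t0 q0 K_large by (simp add: weight_def power2_eq_square)
        also have "\<dots> < e" by fact
        finally have "littlewood_product n x < e" .
        moreover have "N\<^sub>0 \<le> n" using n_ge[OF n] q(1) by simp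
        ultimately show False using x by (auto simp: V_def not_less[symmetric])
      qed
      then show ?thesis unfolding f_def fraction_balls_def by (intro sum.neutral) auto
    qed
    moreover have "\<epsilon> / real N \<le> (\<integral>x. indicator {real i / real N..<(real i + 1) / real N} x * f x \<partial>lebesgue)"
      if i: "i < N" for i
    proof -
      have len: "(real i + 1) / real N - real i / real N = 1 / real N" by (simp add: diff_divide_distrib[symmetric])
      have "\<epsilon> / real N \<le> 1 / real N * (\<Sum>n\<in>good. real n * \<rho> n)"
        using M1 by (simp add: divide_right_mono)
      also have "\<dots> = ((real i + 1) / real N - real i / real N) * (\<Sum>n\<in>good. real n * \<rho> n)" by (simp only: len)
      also have "\<dots> \<le> (\<integral>x. indicator {real i / real N..<(real i + 1) / real N} x * f x \<partial>lebesgue)"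
        unfolding f_def
      proof (rule fraction_balls_local_mass[OF ball_conds g])
        show "(real i + 1) / real N \<le> 1" using i by simp
        show "4 \<le> real n * ((real i + 1) / real N - real i / real N)" if "n \<in> good" for n
        proof -
          have "4 * N \<le> n" using n_ge[OF that] q(1) by simp
          then have "real (4 * N) \<le> real n" by (rule of_nat_mono)
          then show ?thesis unfolding len using N by (simp add: le_divide_eq)
        qed
      qed (use small in simp_all)
      finally show ?thesis .
    qed
    moreover have "integrable lebesgue f" unfolding f_def by (rule fraction_balls_integrable[OF ball_conds])
    moreover have "integrable lebesgue (\<lambda>x. (f x)\<^sup>2)" unfolding f_def by (rule fraction_balls_second_moment(1)[OF ball_conds])
    moreover have "(\<integral>x. (f x)\<^sup>2 \<partial>lebesgue) \<le> C"
    proof -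
      have "(\<integral>x. (f x)\<^sup>2 \<partial>lebesgue) \<le> 8 * (\<Sum>n\<in>good. real n * \<rho> n)\<^sup>2
          + 4 * (\<Sum>m\<in>good. \<Sum>n\<in>{n \<in> good. n \<le> m}. real (gcd n m) * \<rho> m)"
        unfolding f_def by (rule fraction_balls_second_moment(2)[OF ball_conds])
      also have "\<dots> \<le> C"
        unfolding C_def using M1 M2 H \<epsilon> by (intro add_mono mult_left_mono power_mono) auto
      finally show ?thesis .
    qed
    ultimately show "\<exists>f::real \<Rightarrow> real. integrable lebesgue f
      \<and> integrable lebesgue (\<lambda>x. (f x)\<^sup>2) \<and> (\<integral>x. (f x)\<^sup>2 \<partial>lebesgue) \<le> C
      \<and> (\<forall>x\<in>V. f x = 0)
      \<and> (\<forall>i<N. \<epsilon> / real N \<le> (\<integral>x. indicator {real i / real N..<(real i + 1) / real N} x * f x \<partial>lebesgue))"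
      by blast
  qed
  then show ?thesis unfolding V_def .
qed

lemma littlewood_product_nonneg: "littlewood_product n x \<ge> 0"
  by (simp add: littlewood_product_def dist_int_nonneg)

lemma littlewood_product_add_int: "littlewood_product n (x + of_int k) = littlewood_product n x"
proof -
  have "real n * (x + of_int k) - \<gamma>\<^sub>2 = (real n * x - \<gamma>\<^sub>2) + of_int (int n * k)"
    by (simp add: algebra_simps)
  then show ?thesis unfolding littlewood_product_def by (simp only: dist_int_add_int)
qed

lemma liminf_littlewood_product_eq_0:
  assumes "\<And>j N. \<exists>n\<ge>N. littlewood_product n x < 1 / real (Suc j)"
  shows "liminf (\<lambda>n. ereal (littlewood_product n x)) = 0"
proof (rule antisym)
  show "0 \<le> liminf (\<lambda>n. ereal (littlewood_product n x))"
    by (intro Liminf_bounded always_eventually) (simp add: littlewood_product_nonneg)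
  show "liminf (\<lambda>n. ereal (littlewood_product n x)) \<le> 0"
  proof (rule ccontr)
    assume "\<not> liminf (\<lambda>n. ereal (littlewood_product n x)) \<le> 0"
    then obtain y :: real where y: "0 < ereal y" "ereal y < liminf (\<lambda>n. ereal (littlewood_product n x))"
      using ereal_dense2[of 0] by (auto simp: not_le)
    then have "eventually (\<lambda>n. ereal y < ereal (littlewood_product n x)) sequentially"
      by (intro less_LiminfD)
    then obtain N where N: "\<And>n. n \<ge> N \<Longrightarrow> y < littlewood_product n x"
      by (auto simp: eventually_sequentially)
    obtain j where "1 / real (Suc j) < y"
      using y(1) nat_approx_posE[of y] by auto
    then show False using assms[of N j] N by force
  qed
qed

lemma liminf_littlewood_product_AE:
  assumes "liouville_number \<alpha>"
  shows "AE x in lebesgue. liminf (\<lambda>n. ereal (littlewood_product n x)) = 0"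
proof -
  define E where "E = (\<Union>j. \<Union>N. {x \<in> {0..<1}. \<forall>n\<ge>N. 1 / real (Suc j) \<le> littlewood_product n x})"
  have E: "E \<in> null_sets lebesgue"
    unfolding E_def by (intro null_sets_UN littlewood_product_large_null assms) simp
  \<comment> \<open>The product has period 1 in x, so the integer translates of the exceptional set
    in [0, 1) cover the one in the whole line.\<close>
  define B where "B = (\<Union>k::int. (+) (of_int k) ` E)"
  have "B \<in> null_sets lebesgue"
    unfolding B_def using E by (intro null_sets_UN) (metis negligible_iff_null_sets negligible_translation)
  then show ?thesis
  proof (rule AE_I')
    show "{x \<in> space lebesgue. liminf (\<lambda>n. ereal (littlewood_product n x)) \<noteq> 0} \<subseteq> B"
    proof clarify
      fix x assume "liminf (\<lambda>n. ereal (littlewood_product n x)) \<noteq> 0"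
      then obtain j N where jN: "\<And>n. n \<ge> N \<Longrightarrow> 1 / real (Suc j) \<le> littlewood_product n x"
        using liminf_littlewood_product_eq_0[of x] by (meson not_less)
      have "littlewood_product n (frac x) = littlewood_product n x" for n
        using littlewood_product_add_int[of n "frac x" "\<lfloor>x\<rfloor>"] by (simp add: frac_def)
      then have "frac x \<in> E"
        using jN unfolding E_def by (auto simp: frac_lt_1)
      moreover have "x = of_int \<lfloor>x\<rfloor> + frac x" by (simp add: frac_def)
      ultimately show "x \<in> B" unfolding B_def by blast
    qed
  qed
qed

end

theorem theorem1p12:
  fixes \<alpha>\<^sub>1 \<gamma>\<^sub>1 \<gamma>\<^sub>2 :: real
  assumes "liouville_number \<alpha>\<^sub>1"
  shows "AE \<alpha>\<^sub>2 in lebesgue.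
    liminf (\<lambda>n::nat. ereal (real n * (ln (real n))\<^sup>2
      * dist_int (real n * \<alpha>\<^sub>1 - \<gamma>\<^sub>1) * dist_int (real n * \<alpha>\<^sub>2 - \<gamma>\<^sub>2))) = 0"
  using liminf_littlewood_product_AE[OF assms] unfolding littlewood_product_def .

end
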